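(* Let $G=(I,(S_i)_{i\in I},X,P,(g_i)_{i\in I},(\gamma_i)_{i\in I})$ be a stationary mixed strategy stochastic game with $|I|<\infty$ and $|X|<\infty$, and suppose that each $S_i$ is a finite set. Then for any initial stationary joint mixed strategy $\sigma\in\prod_{i\in I}(\Delta S_i)^X$ there exists a finite-length satisficing path $(\sigma^t)_{t=0}^{T}$ of stationary joint mixed strategies such that $\sigma^0=\sigma$ and $\sigma^T$ is a mixed equilibrium of $G$.
   Context: In a stationary mixed strategy stochastic game $G=(I,(S_i)_{i\in I},X,P,(g_i)_{i\in I},(\gamma_i)_{i\in I})$: $I$ is the finite set of players; $S_i$ is the strategy (action) set of player $i$; $X$ is the finite state set; $P:X\times\prod_{i\in I}S_i\to\Delta X$ is the transition probability function; $g_i:X\times\prod_{j\in I}S_j\to\mathbb{R}$ is the payoff function of player $i$; $\gamma_i\in[0,1)$ is the discount factor of player $i$. For a finite set $Y$, $\Delta Y$ is the set of probability distributions on $Y$. A stationary mixed strategy of player $i$ is a map $\pi_i:X\to\Delta S_i$; a stationary joint mixed strategy is $\pi=(\pi_i)_{i\in I}\in\prod_{i\in I}(\Delta S_i)^X$. Given $\pi$ and initial state $x^0=x$, at each time $t\ge0$ the players independently draw $s_i^t\sim\pi_i(x^t)$, forming $s^t=(s_i^t)_{i\in I}$, player $i$ receives $g_i(x^t,s^t)$, and the next state is $x^{t+1}\sim P(x^t,s^t)$. The value of player $i$ is $$V_i^{\pi}(x)=\mathbb{E}_{\pi}\Big[\sum_{t\ge0}\gamma_i^t g_i(x^t,s^t)\,\Big|\,x^0=x\Big].$$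 Player $i$ achieves best response in $\pi=(\pi_i,\pi_{-i})$ if for every $x\in X$, $V_i^{\pi}(x)=\sup_{\sigma_i\in(\Delta S_i)^X}V_i^{(\sigma_i,\pi_{-i})}(x)$. A mixed equilibrium is a stationary joint mixed strategy in which every player achieves best response. A satisficing path $(\sigma^t)_{t=0}^T$ is a sequence of stationary joint mixed strategies such that for every $0\le t<T$ and every $i\in I$: if player $i$ achieves best response in $\sigma^t$, then $\sigma_i^{t+1}=\sigma_i^t$. *)

theory Defs
  imports "HOL-Probability.Probability"
begin

text \<open>Players, states and actions live in ambient types and are carved out by explicit sets, so that
  the action sets may vary with the player. Families indexed by one of these sets are functions
  that are \<^const>\<open>undefined\<close> outside of it (\<^const>\<open>PiE\<close>), which makes equality of strategies
  plain equality.\<close>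

record ('i, 'x, 's) game =
  players :: "'i set"
  actions :: "'i \<Rightarrow> 's set"
  states :: "'x set"
  trans :: "'x \<Rightarrow> ('i \<Rightarrow> 's) \<Rightarrow> 'x pmf"
  payoff :: "'i \<Rightarrow> 'x \<Rightarrow> ('i \<Rightarrow> 's) \<Rightarrow> real"
  discount :: "'i \<Rightarrow> real"

text \<open>The probability distributions on a finite set.\<close>

definition Dist :: "'a set \<Rightarrow> 'a pmf set" where
  "Dist Y = {p. set_pmf p \<subseteq> Y}"

definition joint_actions :: "('i, 'x, 's) game \<Rightarrow> ('i \<Rightarrow> 's) set" where
  "joint_actions G = PiE (players G) (actions G)"

text \<open>Payoffs are total functions; their values outside of the states and joint actions are
  irrelevant, as are those of the transition function.\<close>

definition stochastic_game :: "('i, 'x, 's) game \<Rightarrow> bool" where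
  "stochastic_game G \<longleftrightarrow>
     finite (players G) \<and> finite (states G) \<and>
     (\<forall>x\<in>states G. \<forall>s\<in>joint_actions G. trans G x s \<in> Dist (states G)) \<and>
     (\<forall>i\<in>players G. 0 \<le> discount G i \<and> discount G i < 1)"

definition strategies :: "('i, 'x, 's) game \<Rightarrow> 'i \<Rightarrow> ('x \<Rightarrow> 's pmf) set" where
  "strategies G i = PiE (states G) (\<lambda>_. Dist (actions G i))"

definition joint_strategies :: "('i, 'x, 's) game \<Rightarrow> ('i \<Rightarrow> 'x \<Rightarrow> 's pmf) set" where
  "joint_strategies G = PiE (players G) (strategies G)"

text \<open>A play is a sequence \<open>\<omega>\<close> with \<open>\<omega> t = (x\<^sup>t, s\<^sup>t)\<close>. Its law is the measure on the infinite product
  space that the Ionescu-Tulcea theorem assigns to the kernels giving the conditional distribution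
  of \<open>\<omega> t\<close> given \<open>\<omega> 0, \<dots>, \<omega> (t - 1)\<close>.\<close>

definition draw_actions ::
  "('i, 'x, 's) game \<Rightarrow> ('i \<Rightarrow> 'x \<Rightarrow> 's pmf) \<Rightarrow> 'x \<Rightarrow> ('i \<Rightarrow> 's) pmf" where
  "draw_actions G \<pi> x = Pi_pmf (players G) undefined (\<lambda>i. \<pi> i x)"

definition play_kernel ::
  "('i, 'x, 's) game \<Rightarrow> ('i \<Rightarrow> 'x \<Rightarrow> 's pmf) \<Rightarrow> 'x \<Rightarrow>
   nat \<Rightarrow> (nat \<Rightarrow> 'x \<times> ('i \<Rightarrow> 's)) \<Rightarrow> ('x \<times> ('i \<Rightarrow> 's)) measure" where
  "play_kernel G \<pi> x n \<omega> = measure_pmf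
     (do {y \<leftarrow> (case n of 0 \<Rightarrow> return_pmf x | Suc t \<Rightarrow> trans G (fst (\<omega> t)) (snd (\<omega> t)));
          s \<leftarrow> draw_actions G \<pi> y;
          return_pmf (y, s)})"

definition play_measure ::
  "('i, 'x, 's) game \<Rightarrow> ('i \<Rightarrow> 'x \<Rightarrow> 's pmf) \<Rightarrow> 'x \<Rightarrow> (nat \<Rightarrow> 'x \<times> ('i \<Rightarrow> 's)) measure" where
  "play_measure G \<pi> x =
     projective_family.lim UNIV
       (Ionescu_Tulcea.CI (play_kernel G \<pi> x) (\<lambda>_. count_space UNIV))
       (\<lambda>_. count_space UNIV)"

lemma play_kernel_Ionescu_Tulcea:
  fixes G :: "('i, 'x, 's) game"
  shows "Ionescu_Tulcea (play_kernel G \<pi> x) (\<lambda>_. count_space UNIV)"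
proof (rule Ionescu_Tulcea.intro)
  fix n
  show "play_kernel G \<pi> x n \<in>
      measurable (PiM {0..<n} (\<lambda>_. count_space UNIV)) (subprob_algebra (count_space UNIV))"
  proof (cases n)
    case 0
    then show ?thesis
      by (simp add: play_kernel_def[abs_def] measure_pmf_in_subprob_algebra)
  next
    case (Suc t)
    have "(\<lambda>\<omega>. \<omega> t) \<in> measurable (PiM {0..<n} (\<lambda>_. count_space UNIV))
        (count_space UNIV :: ('x \<times> ('i \<Rightarrow> 's)) measure)"
      using Suc by (intro measurable_component_singleton) auto
    then show ?thesis
      unfolding play_kernel_def[abs_def] Suc nat.case
      by (rule measurable_compose[where g = "\<lambda>z. measure_pmf
          (trans G (fst z) (snd z) \<bind> (\<lambda>y. draw_actions G \<pi> y \<bind> (\<lambda>s. return_pmf (y, s))))"])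
        (simp add: measure_pmf_in_subprob_algebra)
  qed
qed (unfold play_kernel_def, rule measure_pmf.prob_space_axioms)

lemma distr_play_measure:
  assumes "finite J"
  shows "distr (play_measure G \<pi> x) (PiM J (\<lambda>_. count_space UNIV)) (\<lambda>\<omega>. restrict \<omega> J) =
    Ionescu_Tulcea.CI (play_kernel G \<pi> x) (\<lambda>_. count_space UNIV) J"
proof -
  interpret Ionescu_Tulcea "play_kernel G \<pi> x" "\<lambda>_. count_space UNIV"
    by (rule play_kernel_Ionescu_Tulcea)
  show ?thesis
    unfolding play_measure_def using assms by (rule distr_lim)
qed

definition val ::
  "('i, 'x, 's) game \<Rightarrow> 'i \<Rightarrow> ('i \<Rightarrow> 'x \<Rightarrow> 's pmf) \<Rightarrow> 'x \<Rightarrow> real" where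
  "val G i \<pi> x =
     (LINT \<omega>|play_measure G \<pi> x. (\<Sum>t. discount G i ^ t * payoff G i (fst (\<omega> t)) (snd (\<omega> t))))"

definition best_response :: "('i, 'x, 's) game \<Rightarrow> 'i \<Rightarrow> ('i \<Rightarrow> 'x \<Rightarrow> 's pmf) \<Rightarrow> bool" where
  "best_response G i \<pi> \<longleftrightarrow>
     (\<forall>x\<in>states G. val G i \<pi> x = (SUP \<sigma>\<in>strategies G i. val G i (\<pi>(i := \<sigma>)) x))"

definition mixed_equilibrium :: "('i, 'x, 's) game \<Rightarrow> ('i \<Rightarrow> 'x \<Rightarrow> 's pmf) \<Rightarrow> bool" where
  "mixed_equilibrium G \<pi> \<longleftrightarrow>
     \<pi> \<in> joint_strategies G \<and> (\<forall>i\<in>players G. best_response G i \<pi>)"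

definition satisficing_path ::
  "('i, 'x, 's) game \<Rightarrow> nat \<Rightarrow> (nat \<Rightarrow> 'i \<Rightarrow> 'x \<Rightarrow> 's pmf) \<Rightarrow> bool" where
  "satisficing_path G T \<sigma> \<longleftrightarrow>
     (\<forall>t\<le>T. \<sigma> t \<in> joint_strategies G) \<and>
     (\<forall>t<T. \<forall>i\<in>players G. best_response G i (\<sigma> t) \<longrightarrow> \<sigma> (Suc t) i = \<sigma> t i)"

end

theory Submission
  imports Defs "HOL-Computational_Algebra.Polynomial"
begin

text \<open>By induction on the number of satisfied players. If the unsatisfied players can move so that the
  set of satisfied players strictly shrinks, do so. Otherwise let them jump to an equilibrium \<open>y\<close> of the
  game in which the satisfied players keep their strategies. Were some satisfied player unsatisfied at
  \<open>y\<close>, then the same would hold near \<open>y\<close>, whereas at generic fully mixed points near \<open>y\<close> all the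
  players that moved are unsatisfied as well: this would be a move to a strictly smaller set of
  satisfied players. Hence \<open>y\<close> is an equilibrium of the whole game.\<close>

subsection \<open>The law of the play\<close>

text \<open>Jumping to \<open>y\<close> at once could trade one satisfied player for all the movers,
  and then no count decreases; hence the perturbation. It uses an asymmetry: being unsatisfied is an
  open condition, by continuity of the values, whereas a fully mixed best response forces equations.
  In a one-shot game these would be polynomial in the strategies. Here the value solves a linear
  system whose coefficients are polynomial in the strategies, so it is rational, and one real
  parameter suffices: a rational function that is nonzero somewhere has finitely many zeros. The
  point where it is nonzero is the starting profile, where the movers are unsatisfied by definition.
  Continuity, the one-shot deviation principle and rationality are all drawn from the Bellman
  equation. The measure on plays enters that equation through its one-coordinate marginals, because
  expectation and discounted sum commute. When no player is satisfied the set cannot shrink, and the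
  jump is the classical existence of a stationary equilibrium.\<close>

definition draw_pair :: "('i, 'x, 's) game \<Rightarrow> ('i \<Rightarrow> 'x \<Rightarrow> 's pmf) \<Rightarrow> 'x \<Rightarrow> ('x \<times> ('i \<Rightarrow> 's)) pmf" where
  "draw_pair G \<pi> y = draw_actions G \<pi> y \<bind> (\<lambda>s. return_pmf (y, s))"

text \<open>The law of the \<open>t\<close>-th coordinate of a play. The kernels are Markov, so
  these marginals satisfy a recursion of their own, without histories.\<close>

primrec play_pmf ::
  "('i, 'x, 's) game \<Rightarrow> ('i \<Rightarrow> 'x \<Rightarrow> 's pmf) \<Rightarrow> 'x \<Rightarrow> nat \<Rightarrow> ('x \<times> ('i \<Rightarrow> 's)) pmf" where
  "play_pmf G \<pi> x 0 = draw_pair G \<pi> x"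
| "play_pmf G \<pi> x (Suc t) =
    play_pmf G \<pi> x t \<bind> (\<lambda>z. trans G (fst z) (snd z) \<bind> draw_pair G \<pi>)"

text \<open>Associativity of bind turns the recursion around: \<open>play_pmf\<close> appends a last
  step, while the Bellman equation conditions on the first one.\<close>

lemma play_pmf_Suc_first_step:
  "play_pmf G \<pi> x (Suc t) =
    draw_actions G \<pi> x \<bind> (\<lambda>s. trans G x s \<bind> (\<lambda>y. play_pmf G \<pi> y t))"
proof (induction t)
  case 0
  show ?case
    by (simp add: draw_pair_def[abs_def] bind_assoc_pmf bind_return_pmf)
next
  case (Suc t)
  show ?case
    by (subst play_pmf.simps(2), subst Suc) (simp add: bind_assoc_pmf)
qed

context
  fixes G :: "('i, 'x, 's) game" and \<pi> :: "'i \<Rightarrow> 'x \<Rightarrow> 's pmf" and x :: 'x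
begin

interpretation IT: Ionescu_Tulcea "play_kernel G \<pi> x" "\<lambda>_. count_space UNIV"
  by (rule play_kernel_Ionescu_Tulcea)

text \<open>The empty history, at which the compositions of kernels below start: over the empty
  index set it is the one extensional function.\<close>

lemma space_history: "(\<lambda>_. undefined) \<in> space (PiM {0..<0::nat} (\<lambda>_. count_space UNIV))"
  by (simp add: space_PiM)

lemma measurable_history_coordinate:
  "t < m \<Longrightarrow> (\<lambda>\<omega>. \<omega> t) \<in> measurable (IT.C 0 m (\<lambda>_. undefined)) (count_space UNIV)"
  using measurable_component_singleton[of t "{0..<m}" "\<lambda>_. count_space UNIV"]
  by (simp add: measurable_cong_sets[OF IT.sets_C[OF space_history] refl])

lemma distr_eP_last_coordinate:
  assumes "\<omega> \<in> space (PiM {0..<m} (\<lambda>_. count_space UNIV))"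
  shows "distr (IT.eP m \<omega>) (count_space UNIV) (\<lambda>\<omega>. \<omega> m) = play_kernel G \<pi> x m \<omega>"
proof -
  have upd: "fun_upd \<omega> m \<in> measurable (play_kernel G \<pi> x m \<omega>) (PiM {0..<Suc m} (\<lambda>_. count_space UNIV))"
    using assms by (intro measurable_fun_upd[where J = "{0..<m}"]) (auto simp: play_kernel_def)
  have "distr (IT.eP m \<omega>) (count_space UNIV) (\<lambda>\<omega>. \<omega> m) =
      distr (play_kernel G \<pi> x m \<omega>) (count_space UNIV) (\<lambda>z. z)"
    unfolding IT.eP_def by (subst distr_distr[OF _ upd]) (auto simp: comp_def)
  also have "\<dots> = play_kernel G \<pi> x m \<omega>"
    by (rule distr_id2) (simp add: play_kernel_def)
  finally show ?thesis .
qed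

text \<open>The last coordinate of a history is a mixture of the last kernel over shorter histories.
  That kernel reads one coordinate of the history, whose law is the induction hypothesis.\<close>

lemma distr_C_last_coordinate:
  "distr (IT.C 0 (Suc m) (\<lambda>_. undefined)) (count_space UNIV) (\<lambda>\<omega>. \<omega> m) =
    measure_pmf (play_pmf G \<pi> x m)"
proof (induction m)
  let ?C = "\<lambda>m. IT.C 0 m (\<lambda>_. undefined)"
  have step: "distr (?C (Suc m)) (count_space UNIV) (\<lambda>\<omega>. \<omega> m) = ?C m \<bind> play_kernel G \<pi> x m" for m
  proof -
    have "distr (?C (Suc m)) (count_space UNIV) (\<lambda>\<omega>. \<omega> m) =
        ?C m \<bind> (\<lambda>\<omega>. distr (IT.eP m \<omega>) (count_space UNIV) (\<lambda>\<omega>. \<omega> m))"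
      unfolding IT.C.simps add_0
    proof (rule distr_bind)
      show "IT.eP m \<in> measurable (?C m) (subprob_algebra (PiM {0..<Suc m} (\<lambda>_. count_space UNIV)))"
        using IT.measurable_eP[of m]
        by (simp add: measurable_cong_sets[OF IT.sets_C[OF space_history] refl])
      show "space (?C m) \<noteq> {}"
        using IT.prob_space_C[OF space_history] by (rule prob_space.not_empty)
    qed simp
    also have "\<dots> = ?C m \<bind> play_kernel G \<pi> x m"
      by (rule bind_cong_simp) (auto simp: simp_implies_def IT.space_C[OF space_history] distr_eP_last_coordinate)
    finally show ?thesis .
  qed
  {
    case 0
    have "?C 0 \<bind> play_kernel G \<pi> x 0 = play_kernel G \<pi> x 0 (\<lambda>_. undefined)"
      using IT.P[of 0] space_history by (simp add: bind_return)
    also have "\<dots> = measure_pmf (play_pmf G \<pi> x 0)"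
      by (simp add: play_kernel_def draw_pair_def bind_return_pmf)
    finally show ?case
      by (simp only: step)
  next
    case (Suc m)
    let ?K = "\<lambda>z. measure_pmf (trans G (fst z) (snd z) \<bind> draw_pair G \<pi>)"
    have "?C (Suc m) \<bind> play_kernel G \<pi> x (Suc m) = ?C (Suc m) \<bind> (\<lambda>\<omega>. ?K (\<omega> m))"
      by (simp add: play_kernel_def[abs_def] draw_pair_def[abs_def])
    also have "\<dots> = distr (?C (Suc m)) (count_space UNIV) (\<lambda>\<omega>. \<omega> m) \<bind> ?K"
      using IT.prob_space_C[OF space_history, THEN prob_space.not_empty]
      by (intro bind_distr[symmetric, where K = "count_space UNIV"] measurable_history_coordinate)
         (auto simp: measure_pmf_in_subprob_algebra simp del: IT.C.simps)
    also have "\<dots> = measure_pmf (play_pmf G \<pi> x (Suc m))"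
      by (simp add: Suc measure_pmf_bind del: IT.C.simps)
    finally show ?case
      by (simp only: step)
  }
qed

lemma sets_play_measure: "sets (play_measure G \<pi> x) = sets (PiM UNIV (\<lambda>_. count_space UNIV))"
  unfolding play_measure_def by simp

lemma distr_play_measure_coordinate:
  "distr (play_measure G \<pi> x) (count_space UNIV) (\<lambda>\<omega>. \<omega> t) = measure_pmf (play_pmf G \<pi> x t)"
proof -
  let ?N = "count_space UNIV :: ('x \<times> ('i \<Rightarrow> 's)) measure"
  \<comment> \<open>A history that contains coordinate \<open>t\<close> has length at least
    \<open>t + 1\<close>; this selects the composition whose last coordinate is
    \<open>t\<close>.\<close>
  have up: "IT.up_to {t} = Suc t"
    by (rule antisym) (auto simp: IT.up_to_iff Suc_le_eq IT.up_to_less)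
  have r: "(\<lambda>\<omega>. restrict \<omega> {t}) \<in> measurable (IT.C 0 (Suc t) (\<lambda>_. undefined)) (PiM {t} (\<lambda>_. ?N))"
    by (subst measurable_cong_sets[OF IT.sets_C[OF space_history] refl])
       (auto intro!: measurable_restrict)
  have r': "(\<lambda>\<omega>. restrict \<omega> {t}) \<in> measurable (play_measure G \<pi> x) (PiM {t} (\<lambda>_. ?N))"
    by (subst measurable_cong_sets[OF sets_play_measure refl]) (auto intro!: measurable_restrict)
  have "distr (play_measure G \<pi> x) ?N (\<lambda>\<omega>. \<omega> t) =
      distr (distr (play_measure G \<pi> x) (PiM {t} (\<lambda>_. ?N)) (\<lambda>\<omega>. restrict \<omega> {t})) ?N (\<lambda>\<omega>. \<omega> t)"
    by (subst distr_distr[OF _ r']) (auto simp: comp_def)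
  also have "\<dots> = distr (IT.CI {t}) ?N (\<lambda>\<omega>. \<omega> t)"
    by (simp add: distr_play_measure)
  also have "\<dots> = distr (IT.C 0 (Suc t) (\<lambda>_. undefined)) ?N (\<lambda>\<omega>. \<omega> t)"
    unfolding IT.CI_def up by (subst distr_distr[OF _ r]) (auto simp: comp_def)
  finally show ?thesis
    by (simp only: distr_C_last_coordinate)
qed

end

lemma measurable_play_coordinate [measurable]:
  "(\<lambda>\<omega>. \<omega> t) \<in> measurable (play_measure G \<pi> x) (count_space UNIV)"
  by (subst measurable_cong_sets[OF sets_play_measure refl]) simp

lemma prob_space_play_measure: "prob_space (play_measure G \<pi> x)"
  by (rule prob_space_distrD[OF measurable_play_coordinate])
     (simp add: distr_play_measure_coordinate measure_pmf.prob_space_axioms)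

lemma draw_actions_joint_actions:
  assumes "finite (players G)" "\<pi> \<in> joint_strategies G" "x \<in> states G"
  shows "set_pmf (draw_actions G \<pi> x) \<subseteq> joint_actions G"
proof -
  have "set_pmf (\<pi> i x) \<subseteq> actions G i" if "i \<in> players G" for i
    using assms that by (auto simp: joint_strategies_def strategies_def Dist_def PiE_iff subset_iff)
  then show ?thesis
    using assms(1)
    by (fastforce simp: draw_actions_def set_Pi_pmf joint_actions_def PiE_dflt_def PiE_iff extensional_def)
qed

text \<open>Payoffs and transitions are arbitrary off these sets; the play almost surely never
  leaves them.\<close>

lemma set_play_pmf:
  assumes "stochastic_game G" "\<pi> \<in> joint_strategies G" "x \<in> states G"
  shows "set_pmf (play_pmf G \<pi> x t) \<subseteq> states G \<times> joint_actions G"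
proof (induction t)
  case 0
  then show ?case
    using assms draw_actions_joint_actions[of G \<pi> x]
    by (auto simp: stochastic_game_def draw_pair_def)
next
  case (Suc t)
  show ?case
  proof (clarsimp simp: draw_pair_def)
    fix y s z s'
    assume "(y, s) \<in> set_pmf (play_pmf G \<pi> x t)" "z \<in> set_pmf (trans G y s)"
      and s': "s' \<in> set_pmf (draw_actions G \<pi> z)"
    then have "z \<in> states G"
      using Suc assms by (auto simp: stochastic_game_def Dist_def)
    then show "z \<in> states G \<and> s' \<in> joint_actions G"
      using assms draw_actions_joint_actions[of G \<pi> z] s' by (auto simp: stochastic_game_def)
  qed
qed

subsection \<open>Bellman equation and best responses\<close>

text \<open>The evaluation operator of the fixed profile \<open>\<pi>\<close> (no maximum is taken).
  As a finite sum it is visibly affine in \<open>V\<close> and polynomial in the mixing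
  probabilities, which later gives rationality and continuity.\<close>

definition bellman ::
  "('i, 'x, 's) game \<Rightarrow> 'i \<Rightarrow> ('i \<Rightarrow> 'x \<Rightarrow> 's pmf) \<Rightarrow> ('x \<Rightarrow> real) \<Rightarrow> 'x \<Rightarrow> real" where
  "bellman G i \<pi> V x =
     (\<Sum>s\<in>joint_actions G. (\<Prod>j\<in>players G. pmf (\<pi> j x) (s j)) *
        (payoff G i x s + discount G i * (\<Sum>y\<in>states G. pmf (trans G x s) y * V y)))"

lemma finite_joint_actions:
  assumes "stochastic_game G" "\<And>i. i \<in> players G \<Longrightarrow> finite (actions G i)"
  shows "finite (joint_actions G)"
  using assms by (auto simp: stochastic_game_def joint_actions_def intro!: finite_PiE)

lemma pmf_draw_actions:
  assumes "finite (players G)" "s \<in> joint_actions G"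
  shows "pmf (draw_actions G \<pi> x) s = (\<Prod>j\<in>players G. pmf (\<pi> j x) (s j))"
  using assms unfolding draw_actions_def joint_actions_def
  by (intro pmf_Pi') (auto simp: PiE_iff extensional_def)

text \<open>The value is the discounted series of the expected payoffs \<open>e x t\<close>.
  Splitting off the first term and conditioning the others on the first step gives the same series
  at the next state.\<close>

lemma val_bellman:
  assumes G: "stochastic_game G" and fin: "\<And>i. i \<in> players G \<Longrightarrow> finite (actions G i)"
    and \<pi>: "\<pi> \<in> joint_strategies G" and i: "i \<in> players G" and x: "x \<in> states G"
  shows "val G i \<pi> x = bellman G i \<pi> (val G i \<pi>) x"
proof -
  let ?\<gamma> = "discount G i"
  define Z where "Z = states G \<times> joint_actions G"
  \<comment> \<open>Cutting the payoff off outside the finite set \<open>Z\<close> makes it bounded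
    everywhere, by \<open>C\<close>, without changing it along almost every play. The inserted
    \<open>0\<close> in \<open>C\<close> covers the points outside \<open>Z\<close>.\<close>
  define g where "g = (\<lambda>z. if z \<in> Z then payoff G i (fst z) (snd z) else 0)"
  define e where "e = (\<lambda>y t. measure_pmf.expectation (play_pmf G \<pi> y t) g)"
  define C where "C = Max (insert 0 ((\<lambda>z. \<bar>g z\<bar>) ` Z))"
  have \<gamma>: "0 \<le> ?\<gamma>" "?\<gamma> < 1" and finX: "finite (states G)" and finI: "finite (players G)"
    using G i by (auto simp: stochastic_game_def)
  have finJ: "finite (joint_actions G)"
    using G fin by (rule finite_joint_actions)
  have finZ: "finite Z"
    using finJ finX by (simp add: Z_def)
  have g: "\<bar>g z\<bar> \<le> C" for z
    using finZ by (auto simp: C_def g_def intro!: Max_ge)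
  have supp: "set_pmf (play_pmf G \<pi> y t) \<subseteq> Z" if "y \<in> states G" for y t
    using set_play_pmf[OF G \<pi> that] by (simp add: Z_def)
  have e_le: "\<bar>e y t\<bar> \<le> C" for y t
  proof -
    have "\<bar>e y t\<bar> \<le> measure_pmf.expectation (play_pmf G \<pi> y t) (\<lambda>_. C)"
      unfolding e_def
      by (rule order_trans[OF integral_abs_bound], rule integral_mono)
         (auto intro!: measure_pmf.integrable_const_bound[where B = C] simp: g)
    then show ?thesis by simp
  qed
  have summable_e: "summable (\<lambda>t. ?\<gamma> ^ t * e y t)" for y
  proof (rule summable_comparison_test')
    show "summable (\<lambda>t. ?\<gamma> ^ t * C)"
      using \<gamma> by (intro summable_mult2 summable_geometric) auto
    show "norm (?\<gamma> ^ t * e y t) \<le> ?\<gamma> ^ t * C" for t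
      using \<gamma> e_le by (auto simp: abs_mult intro!: mult_left_mono)
  qed
  \<comment> \<open>The geometric series of \<open>?\<gamma> ^ t * C\<close> dominates, so integral
    and series may be exchanged, and each term depends on one marginal only.\<close>
  have val: "val G i \<pi> y = (\<Sum>t. ?\<gamma> ^ t * e y t)" if y: "y \<in> states G" for y
  proof -
    let ?M = "play_measure G \<pi> y"
    interpret prob_space ?M
      by (rule prob_space_play_measure)
    have meas [measurable]: "(\<lambda>\<omega>. h (\<omega> t)) \<in> borel_measurable ?M" for h :: "_ \<Rightarrow> real" and t
      by (rule measurable_compose[OF measurable_play_coordinate]) simp
    have law: "(LINT \<omega>|?M. h (\<omega> t)) = measure_pmf.expectation (play_pmf G \<pi> y t) h"
      for h :: "_ \<Rightarrow> real" and t
      by (simp flip: distr_play_measure_coordinate add: integral_distr)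
    have bound: "norm (?\<gamma> ^ t * g z) \<le> ?\<gamma> ^ t * C" for t z
      using \<gamma> g[of z] by (simp add: abs_mult mult_left_mono)
    have geo: "summable (\<lambda>t. ?\<gamma> ^ t * C)"
      using \<gamma> by (intro summable_mult2 summable_geometric) auto
    have int: "integrable ?M (\<lambda>\<omega>. ?\<gamma> ^ t * g (\<omega> t))" for t
      using bound by (intro integrable_const_bound[where B = "?\<gamma> ^ t * C"]) auto
    have "AE \<omega> in ?M. \<omega> t \<in> Z" for t
    proof -
      have "AE z in distr ?M (count_space UNIV) (\<lambda>\<omega>. \<omega> t). z \<in> Z"
        unfolding distr_play_measure_coordinate AE_measure_pmf_iff using supp[OF y, of t] by blast
      then show ?thesis
        by (subst (asm) AE_distr_iff) auto
    qed
    then have "AE \<omega> in ?M. \<forall>t. \<omega> t \<in> Z"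
      by (simp add: AE_all_countable)
    then have "AE \<omega> in ?M. (\<Sum>t. ?\<gamma> ^ t * payoff G i (fst (\<omega> t)) (snd (\<omega> t))) = (\<Sum>t. ?\<gamma> ^ t * g (\<omega> t))"
      by eventually_elim (simp add: g_def)
    moreover have "(\<lambda>\<omega>. \<Sum>t. ?\<gamma> ^ t * payoff G i (fst (\<omega> t)) (snd (\<omega> t))) \<in> borel_measurable ?M"
      using meas[of "\<lambda>z. payoff G i (fst z) (snd z)"] by measurable
    ultimately have "val G i \<pi> y = (LINT \<omega>|?M. (\<Sum>t. ?\<gamma> ^ t * g (\<omega> t)))"
      unfolding val_def by (intro integral_cong_AE) auto
    also have "\<dots> = (\<Sum>t. LINT \<omega>|?M. ?\<gamma> ^ t * g (\<omega> t))"
    proof (rule integral_suminf)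
      show "AE \<omega> in ?M. summable (\<lambda>t. norm (?\<gamma> ^ t * g (\<omega> t)))"
        using bound by (intro AE_I2 summable_comparison_test'[OF geo]) auto
      show "summable (\<lambda>t. LINT \<omega>|?M. norm (?\<gamma> ^ t * g (\<omega> t)))"
      proof (rule summable_comparison_test'[OF geo])
        fix t :: nat
        have "(LINT \<omega>|?M. norm (?\<gamma> ^ t * g (\<omega> t))) \<le> (LINT \<omega>|?M. ?\<gamma> ^ t * C)"
          using bound int by (intro integral_mono) auto
        then show "norm (LINT \<omega>|?M. norm (?\<gamma> ^ t * g (\<omega> t))) \<le> ?\<gamma> ^ t * C"
          by (simp add: prob_space)
      qed
    qed (use int in auto)
    also have "\<dots> = (\<Sum>t. ?\<gamma> ^ t * e y t)"
      by (simp add: law e_def)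
    finally show ?thesis .
  qed
  have finsupp: "finite (set_pmf (play_pmf G \<pi> y t))" if "y \<in> states G" for y t
    using supp[OF that] finZ by (rule finite_subset)
  have trans_states: "set_pmf (trans G x s) \<subseteq> states G" if "s \<in> joint_actions G" for s
    using G x that by (auto simp: stochastic_game_def Dist_def)
  have e_Suc: "e x (Suc t) = (\<Sum>s\<in>joint_actions G. pmf (draw_actions G \<pi> x) s *
      (\<Sum>y\<in>states G. pmf (trans G x s) y * e y t))" for t
  proof -
    have fin2: "finite (set_pmf (trans G x s \<bind> (\<lambda>y. play_pmf G \<pi> y t)))" if "s \<in> joint_actions G" for s
      using trans_states[OF that] finsupp finite_subset[OF trans_states[OF that] finX] by auto
    have "e x (Suc t) = (\<Sum>s\<in>joint_actions G. pmf (draw_actions G \<pi> x) s *\<^sub>R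
        measure_pmf.expectation (trans G x s \<bind> (\<lambda>y. play_pmf G \<pi> y t)) g)"
      unfolding e_def play_pmf_Suc_first_step using finJ fin2 draw_actions_joint_actions[OF finI \<pi> x]
      by (rule pmf_expectation_bind)
    also have "\<dots> = (\<Sum>s\<in>joint_actions G. pmf (draw_actions G \<pi> x) s *
        (\<Sum>y\<in>states G. pmf (trans G x s) y * e y t))"
      using finX finsupp trans_states
      by (intro sum.cong refl) (simp add: e_def pmf_expectation_bind[of "states G"])
    finally show ?thesis .
  qed
  have e_0: "e x 0 = (\<Sum>s\<in>joint_actions G. pmf (draw_actions G \<pi> x) s * payoff G i x s)"
  proof -
    have "e x 0 = (\<Sum>s\<in>joint_actions G. pmf (draw_actions G \<pi> x) s *\<^sub>R
        measure_pmf.expectation (return_pmf (x, s)) g)"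
      unfolding e_def play_pmf.simps draw_pair_def using finJ draw_actions_joint_actions[OF finI \<pi> x]
      by (intro pmf_expectation_bind) auto
    then show ?thesis
      using x by (simp add: g_def Z_def)
  qed
  have "val G i \<pi> x = e x 0 + (\<Sum>t. ?\<gamma> ^ Suc t * e x (Suc t))"
    using suminf_split_head[OF summable_e[of x]] by (simp add: val[OF x])
  also have "(\<Sum>t. ?\<gamma> ^ Suc t * e x (Suc t)) = (\<Sum>t. \<Sum>s\<in>joint_actions G. pmf (draw_actions G \<pi> x) s *
      (?\<gamma> * (\<Sum>y\<in>states G. pmf (trans G x s) y * (?\<gamma> ^ t * e y t))))"
    by (simp add: e_Suc sum_distrib_left mult_ac)
  also have "\<dots> = (\<Sum>s\<in>joint_actions G. pmf (draw_actions G \<pi> x) s *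
      (?\<gamma> * (\<Sum>y\<in>states G. pmf (trans G x s) y * val G i \<pi> y)))"
    by (rule sums_unique[symmetric], intro sums_sum sums_mult)
       (auto simp: val intro!: summable_sums summable_e)
  finally show ?thesis
    by (simp add: bellman_def e_0 pmf_draw_actions[OF finI] distrib_left sum.distrib)
qed

text \<open>The Q-function: play \<open>a\<close> once at \<open>x\<close>, then receive
  \<open>V\<close>. The product omits player \<open>i\<close>, so the strategy of \<open>i\<close>
  can enter only through \<open>V\<close>.\<close>

definition action_value ::
  "('i, 'x, 's) game \<Rightarrow> 'i \<Rightarrow> ('i \<Rightarrow> 'x \<Rightarrow> 's pmf) \<Rightarrow> ('x \<Rightarrow> real) \<Rightarrow> 'x \<Rightarrow> 's \<Rightarrow> real" where
  "action_value G i \<pi> V x a =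
     (\<Sum>s\<in>{s \<in> joint_actions G. s i = a}. (\<Prod>j\<in>players G - {i}. pmf (\<pi> j x) (s j)) *
        (payoff G i x s + discount G i * (\<Sum>y\<in>states G. pmf (trans G x s) y * V y)))"

lemma action_value_upd [simp]: "action_value G i (\<pi>(i := \<sigma>)) V x a = action_value G i \<pi> V x a"
  unfolding action_value_def by (intro sum.cong refl arg_cong2[where f = "(*)"] prod.cong) auto

locale finite_stochastic_game =
  fixes G :: "('i, 'x, 's) game"
  assumes game: "stochastic_game G"
    and finite_actions: "\<And>i. i \<in> players G \<Longrightarrow> finite (actions G i)"
begin

lemma finite_players: "finite (players G)" and finite_states: "finite (states G)"
  using game by (auto simp: stochastic_game_def)

lemma discount: "i \<in> players G \<Longrightarrow> 0 \<le> discount G i" "i \<in> players G \<Longrightarrow> discount G i < 1"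
  using game by (auto simp: stochastic_game_def)

lemmas finite_joint = finite_joint_actions[OF game finite_actions]

lemma sum_trans:
  assumes "x \<in> states G" "s \<in> joint_actions G"
  shows "(\<Sum>y\<in>states G. pmf (trans G x s) y) = 1"
  using assms game finite_states by (intro sum_pmf_eq_1) (auto simp: stochastic_game_def Dist_def)

lemma sum_joint:
  assumes "\<pi> \<in> joint_strategies G" "x \<in> states G"
  shows "(\<Sum>s\<in>joint_actions G. \<Prod>j\<in>players G. pmf (\<pi> j x) (s j)) = 1"
  using sum_pmf_eq_1[OF finite_joint draw_actions_joint_actions[OF finite_players assms]]
  by (simp add: pmf_draw_actions[OF finite_players])

lemma joint_strategies_upd:
  assumes "\<pi> \<in> joint_strategies G" "i \<in> players G" "\<sigma> \<in> strategies G i"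
  shows "\<pi>(i := \<sigma>) \<in> joint_strategies G"
  using assms by (auto simp: joint_strategies_def PiE_iff extensional_def)

lemma sum_strategy:
  assumes "\<sigma> \<in> strategies G i" "i \<in> players G" "x \<in> states G"
  shows "(\<Sum>a\<in>actions G i. pmf (\<sigma> x) a) = 1"
  using assms finite_actions by (intro sum_pmf_eq_1) (auto simp: strategies_def Dist_def PiE_iff)

lemma strategyI: "\<pi> \<in> joint_strategies G \<Longrightarrow> i \<in> players G \<Longrightarrow> \<pi> i \<in> strategies G i"
  by (auto simp: joint_strategies_def)

section \<open>Monotonicity and contraction of the Bellman operator\<close>

lemma joint_average_le:
  assumes "\<pi> \<in> joint_strategies G" "x \<in> states G" "\<And>s. s \<in> joint_actions G \<Longrightarrow> f s \<le> c"
  shows "(\<Sum>s\<in>joint_actions G. (\<Prod>j\<in>players G. pmf (\<pi> j x) (s j)) * f s) \<le> c"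
proof -
  have "(\<Sum>s\<in>joint_actions G. (\<Prod>j\<in>players G. pmf (\<pi> j x) (s j)) * f s) \<le>
      (\<Sum>s\<in>joint_actions G. (\<Prod>j\<in>players G. pmf (\<pi> j x) (s j)) * c)"
    using assms(3) by (intro sum_mono mult_left_mono prod_nonneg) auto
  also have "\<dots> = c"
    by (simp add: sum_joint[OF assms(1,2)] flip: sum_distrib_right)
  finally show ?thesis .
qed

lemma trans_average_le:
  assumes "x \<in> states G" "s \<in> joint_actions G" "\<And>y. y \<in> states G \<Longrightarrow> f y \<le> c"
  shows "(\<Sum>y\<in>states G. pmf (trans G x s) y * f y) \<le> c"
proof -
  have "(\<Sum>y\<in>states G. pmf (trans G x s) y * f y) \<le> (\<Sum>y\<in>states G. pmf (trans G x s) y * c)"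
    using assms(3) by (intro sum_mono mult_left_mono) auto
  also have "\<dots> = c"
    by (simp add: sum_trans[OF assms(1,2)] flip: sum_distrib_right)
  finally show ?thesis .
qed

lemma bellman_diff:
  "bellman G i \<pi> V x - bellman G i \<pi> U x =
    (\<Sum>s\<in>joint_actions G. (\<Prod>j\<in>players G. pmf (\<pi> j x) (s j)) *
       (discount G i * (\<Sum>y\<in>states G. pmf (trans G x s) y * (V y - U y))))"
  by (simp add: bellman_def right_diff_distrib distrib_left sum_subtractf sum.distrib)

lemma bellman_diff_le:
  assumes "\<pi> \<in> joint_strategies G" "i \<in> players G" "x \<in> states G"
    and "\<And>y. y \<in> states G \<Longrightarrow> V y - U y \<le> c"
  shows "bellman G i \<pi> V x - bellman G i \<pi> U x \<le> discount G i * c"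
  unfolding bellman_diff using assms discount
  by (intro joint_average_le mult_left_mono trans_average_le) auto

text \<open>At a state where \<open>V - U\<close> attains its maximum \<open>D\<close>, the
  hypotheses and the contraction give \<open>D \<le> discount G i * D\<close>, hence
  \<open>D \<le> 0\<close>. Subsolutions thus lie below supersolutions; uniqueness, bounds and
  policy improvement below are instances.\<close>

lemma bellman_comparison:
  assumes \<pi>: "\<pi> \<in> joint_strategies G" and i: "i \<in> players G"
    and V: "\<And>x. x \<in> states G \<Longrightarrow> V x \<le> bellman G i \<pi> V x"
    and U: "\<And>x. x \<in> states G \<Longrightarrow> bellman G i \<pi> U x \<le> U x"
    and x: "x \<in> states G"
  shows "V x \<le> U x"
proof -
  define D where "D = Max ((\<lambda>x. V x - U x) ` states G)"
  have D: "V y - U y \<le> D" if "y \<in> states G" for y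
    using that finite_states by (auto simp: D_def)
  have "D \<in> (\<lambda>x. V x - U x) ` states G"
    unfolding D_def using finite_states x by (intro Max_in) auto
  then obtain z where z: "z \<in> states G" "D = V z - U z"
    by auto
  have "D \<le> bellman G i \<pi> V z - bellman G i \<pi> U z"
    using V U z by fastforce
  also have "\<dots> \<le> discount G i * D"
    using \<pi> i z(1) D by (rule bellman_diff_le)
  finally have "(1 - discount G i) * D \<le> 0"
    by (simp add: algebra_simps)
  then have "D \<le> 0"
    using discount[OF i] by (simp add: mult_le_0_iff)
  then show ?thesis
    using D[OF x] by simp
qed

lemma val_eq_bellman:
  assumes "\<pi> \<in> joint_strategies G" "i \<in> players G" "x \<in> states G"
  shows "val G i \<pi> x = bellman G i \<pi> (val G i \<pi>) x"
  using game finite_actions assms by (rule val_bellman)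

lemma val_unique:
  assumes "\<pi> \<in> joint_strategies G" "i \<in> players G"
    and "\<And>x. x \<in> states G \<Longrightarrow> V x = bellman G i \<pi> V x" "x \<in> states G"
  shows "V x = val G i \<pi> x"
proof (rule antisym)
  note val = val_eq_bellman[OF assms(1,2)]
  show "V x \<le> val G i \<pi> x"
    by (rule bellman_comparison[OF assms(1,2) eq_refl[OF assms(3)] eq_refl[OF val[symmetric]] assms(4)])
  show "val G i \<pi> x \<le> V x"
    by (rule bellman_comparison[OF assms(1,2) eq_refl[OF val] eq_refl[OF assms(3)[symmetric]] assms(4)])
qed

text \<open>The bound is uniform in the profile, so the \<open>SUP\<close> in
  \<open>best_response\<close> is a genuine supremum.\<close>

lemma bdd_above_val:
  assumes i: "i \<in> players G"
  shows "\<exists>K. \<forall>\<pi>\<in>joint_strategies G. \<forall>x\<in>states G. val G i \<pi> x \<le> K"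
proof -
  define C where "C = Max ((\<lambda>(x, s). payoff G i x s) ` (states G \<times> joint_actions G))"
  \<comment> \<open>The fixed point of \<open>r \<mapsto> C + discount G i * r\<close>, so the
    constant function \<open>K\<close> is a supersolution for every profile.\<close>
  define K where "K = C / (1 - discount G i)"
  have C: "payoff G i x s \<le> C" if "x \<in> states G" "s \<in> joint_actions G" for x s
    unfolding C_def using that finite_states finite_joint by (intro Max_ge) auto
  have K: "C + discount G i * K = K"
    using discount[OF i] by (simp add: K_def field_simps)
  have "val G i \<pi> x \<le> K" if \<pi>: "\<pi> \<in> joint_strategies G" and x: "x \<in> states G" for \<pi> x
  proof (rule bellman_comparison[OF \<pi> i _ _ x])
    show "val G i \<pi> y \<le> bellman G i \<pi> (val G i \<pi>) y" if "y \<in> states G" for y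
      by (rule eq_refl[OF val_eq_bellman[OF \<pi> i that]])
    show "bellman G i \<pi> (\<lambda>_. K) y \<le> K" if "y \<in> states G" for y
      unfolding bellman_def using \<pi> that
    proof (rule joint_average_le)
      fix s assume s: "s \<in> joint_actions G"
      have "(\<Sum>z\<in>states G. pmf (trans G y s) z * K) = K"
        by (simp add: sum_trans[OF that s] flip: sum_distrib_right)
      then show "payoff G i y s + discount G i * (\<Sum>z\<in>states G. pmf (trans G y s) z * K) \<le> K"
        using C[OF that s] K by simp
    qed
  qed
  then show ?thesis
    by blast
qed

text \<open>Since \<open>\<pi> i\<close> is itself a competitor, its value equals the supremum as
  soon as it is an upper bound; the converse uses boundedness.\<close>

lemma best_response_iff:
  assumes \<pi>: "\<pi> \<in> joint_strategies G" and i: "i \<in> players G"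
  shows "best_response G i \<pi> \<longleftrightarrow>
    (\<forall>x\<in>states G. \<forall>\<sigma>\<in>strategies G i. val G i (\<pi>(i := \<sigma>)) x \<le> val G i \<pi> x)"
proof -
  obtain K where K: "val G i \<pi>' x \<le> K" if "\<pi>' \<in> joint_strategies G" "x \<in> states G" for \<pi>' x
    using bdd_above_val[OF i] by blast
  have "val G i \<pi> x = (SUP \<sigma>\<in>strategies G i. val G i (\<pi>(i := \<sigma>)) x) \<longleftrightarrow>
      (\<forall>\<sigma>\<in>strategies G i. val G i (\<pi>(i := \<sigma>)) x \<le> val G i \<pi> x)" if x: "x \<in> states G" for x
  proof -
    have bdd: "bdd_above ((\<lambda>\<sigma>. val G i (\<pi>(i := \<sigma>)) x) ` strategies G i)"
      using K[OF joint_strategies_upd[OF \<pi> i] x] by (auto intro!: bdd_aboveI)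
    have own: "val G i \<pi> x \<in> (\<lambda>\<sigma>. val G i (\<pi>(i := \<sigma>)) x) ` strategies G i"
      using strategyI[OF \<pi> i] by (force intro!: image_eqI[of _ _ "\<pi> i"])
    show ?thesis
    proof
      assume eq: "val G i \<pi> x = (SUP \<sigma>\<in>strategies G i. val G i (\<pi>(i := \<sigma>)) x)"
      show "\<forall>\<sigma>\<in>strategies G i. val G i (\<pi>(i := \<sigma>)) x \<le> val G i \<pi> x"
        unfolding eq using bdd by (auto intro!: cSUP_upper)
    next
      assume "\<forall>\<sigma>\<in>strategies G i. val G i (\<pi>(i := \<sigma>)) x \<le> val G i \<pi> x"
      then show "val G i \<pi> x = (SUP \<sigma>\<in>strategies G i. val G i (\<pi>(i := \<sigma>)) x)"
        using own by (intro cSup_eq_maximum[symmetric]) auto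
    qed
  qed
  then show ?thesis
    unfolding best_response_def by blast
qed

section \<open>Action values and one-shot deviations\<close>

lemma bellman_action_value:
  assumes i: "i \<in> players G"
  shows "bellman G i \<pi> V x = (\<Sum>a\<in>actions G i. pmf (\<pi> i x) a * action_value G i \<pi> V x a)"
proof -
  let ?F = "\<lambda>s. payoff G i x s + discount G i * (\<Sum>y\<in>states G. pmf (trans G x s) y * V y)"
  have "bellman G i \<pi> V x = (\<Sum>a\<in>actions G i. \<Sum>s\<in>{s \<in> joint_actions G. s i = a}.
      (\<Prod>j\<in>players G. pmf (\<pi> j x) (s j)) * ?F s)"
    unfolding bellman_def using i finite_joint finite_actions
    by (intro sum.group[symmetric]) (auto simp: joint_actions_def)
  also have "\<dots> = (\<Sum>a\<in>actions G i. pmf (\<pi> i x) a * action_value G i \<pi> V x a)"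
    unfolding action_value_def sum_distrib_left
    by (intro sum.cong refl) (auto simp: prod.remove[OF finite_players i])
  finally show ?thesis .
qed

lemma val_action_value:
  assumes "\<pi> \<in> joint_strategies G" "i \<in> players G" "x \<in> states G"
  shows "val G i \<pi> x = (\<Sum>a\<in>actions G i. pmf (\<pi> i x) a * action_value G i \<pi> (val G i \<pi>) x a)"
  by (subst val_eq_bellman[OF assms]) (rule bellman_action_value[OF assms(2)])

lemma return_pmf_upd_strategies:
  assumes "\<sigma> \<in> strategies G i" "x \<in> states G" "a \<in> actions G i"
  shows "\<sigma>(x := return_pmf a) \<in> strategies G i"
  using assms by (auto simp: strategies_def Dist_def PiE_iff extensional_def)

text \<open>The one-shot deviation principle. If no action gains, the value is a supersolution of
  the Bellman equation of every deviation, and comparison applies. If some action gains, policy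
  improvement gives a better stationary strategy.\<close>

lemma best_response_iff_action_value:
  assumes \<pi>: "\<pi> \<in> joint_strategies G" and i: "i \<in> players G"
  shows "best_response G i \<pi> \<longleftrightarrow>
    (\<forall>x\<in>states G. \<forall>a\<in>actions G i. action_value G i \<pi> (val G i \<pi>) x a \<le> val G i \<pi> x)"
proof
  assume R: "\<forall>x\<in>states G. \<forall>a\<in>actions G i. action_value G i \<pi> (val G i \<pi>) x a \<le> val G i \<pi> x"
  have "val G i (\<pi>(i := \<sigma>)) x \<le> val G i \<pi> x" if x: "x \<in> states G" and \<sigma>: "\<sigma> \<in> strategies G i" for x \<sigma>
  proof (rule bellman_comparison[OF joint_strategies_upd[OF \<pi> i \<sigma>] i _ _ x])
    show "val G i (\<pi>(i := \<sigma>)) y \<le> bellman G i (\<pi>(i := \<sigma>)) (val G i (\<pi>(i := \<sigma>))) y"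
      if "y \<in> states G" for y
      by (rule eq_refl[OF val_eq_bellman[OF joint_strategies_upd[OF \<pi> i \<sigma>] i that]])
    show "bellman G i (\<pi>(i := \<sigma>)) (val G i \<pi>) y \<le> val G i \<pi> y" if y: "y \<in> states G" for y
    proof -
      have "bellman G i (\<pi>(i := \<sigma>)) (val G i \<pi>) y \<le> (\<Sum>a\<in>actions G i. pmf (\<sigma> y) a * val G i \<pi> y)"
        unfolding bellman_action_value[OF i] using R y
        by (auto intro!: sum_mono mult_left_mono)
      also have "\<dots> = val G i \<pi> y"
        by (simp add: sum_strategy[OF \<sigma> i y] flip: sum_distrib_right)
      finally show ?thesis .
    qed
  qed
  then show "best_response G i \<pi>"
    by (simp add: best_response_iff[OF \<pi> i])
next
  assume br: "best_response G i \<pi>"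
  show "\<forall>x\<in>states G. \<forall>a\<in>actions G i. action_value G i \<pi> (val G i \<pi>) x a \<le> val G i \<pi> x"
  proof (intro ballI, rule ccontr)
    fix x a assume x: "x \<in> states G" and a: "a \<in> actions G i"
      and less: "\<not> action_value G i \<pi> (val G i \<pi>) x a \<le> val G i \<pi> x"
    \<comment> \<open>Deviating at \<open>x\<close> only keeps the Bellman equation intact at all
      other states, so the old value is a subsolution, strict at \<open>x\<close>.\<close>
    let ?\<sigma> = "(\<pi> i)(x := return_pmf a)"
    let ?\<pi> = "\<pi>(i := ?\<sigma>)"
    have \<sigma>: "?\<sigma> \<in> strategies G i"
      using strategyI[OF \<pi> i] x a by (rule return_pmf_upd_strategies)
    then have \<pi>': "?\<pi> \<in> joint_strategies G"
      by (rule joint_strategies_upd[OF \<pi> i])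
    have at: "bellman G i ?\<pi> (val G i \<pi>) x = action_value G i \<pi> (val G i \<pi>) x a"
    proof -
      have "bellman G i ?\<pi> (val G i \<pi>) x =
          (\<Sum>b\<in>actions G i. if b = a then action_value G i \<pi> (val G i \<pi>) x b else 0)"
        unfolding bellman_action_value[OF i] by (intro sum.cong) (auto simp: indicator_def)
      then show ?thesis
        using a finite_actions[OF i] by simp
    qed
    have le: "val G i \<pi> y \<le> bellman G i ?\<pi> (val G i \<pi>) y" if y: "y \<in> states G" for y
    proof (cases "y = x")
      case False
      then have "bellman G i ?\<pi> (val G i \<pi>) y = bellman G i \<pi> (val G i \<pi>) y"
        unfolding bellman_action_value[OF i] by (intro sum.cong) auto
      then show ?thesis
        using val_eq_bellman[OF \<pi> i y] by (simp only: order.refl)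
    qed (use at less in simp)
    have ge: "val G i \<pi> y \<le> val G i ?\<pi> y" if "y \<in> states G" for y
      by (rule bellman_comparison[OF \<pi>' i le eq_refl[OF val_eq_bellman[OF \<pi>' i, symmetric]] that])
    \<comment> \<open>\<open>bellman_diff_le\<close> with bound \<open>0\<close> is monotonicity: it
      carries the strict gain at \<open>x\<close> over from the old continuation value to the new
      one.\<close>
    have "bellman G i ?\<pi> (val G i \<pi>) x - bellman G i ?\<pi> (val G i ?\<pi>) x \<le> discount G i * 0"
      using \<pi>' i x ge by (intro bellman_diff_le) auto
    then have "val G i \<pi> x < val G i ?\<pi> x"
      using at less val_eq_bellman[OF \<pi>' i x] by linarith
    then show False
      using br \<sigma> x by (fastforce simp: best_response_iff[OF \<pi> i])
  qed
qed

text \<open>The value at a state averages the action values with positive weights, and none of them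
  exceeds it, so all are equal to it. The value then solves the Bellman equation of every deviation,
  and solutions are unique.\<close>

lemma fully_mixed_best_response_indifferent:
  assumes \<pi>: "\<pi> \<in> joint_strategies G" and i: "i \<in> players G" and br: "best_response G i \<pi>"
    and full: "\<And>x a. x \<in> states G \<Longrightarrow> a \<in> actions G i \<Longrightarrow> pmf (\<pi> i x) a > 0"
    and \<sigma>: "\<sigma> \<in> strategies G i" and x: "x \<in> states G"
  shows "val G i (\<pi>(i := \<sigma>)) x = val G i \<pi> x"
proof -
  let ?V = "val G i \<pi>"
  have eq: "action_value G i \<pi> ?V y a = ?V y" if y: "y \<in> states G" and a: "a \<in> actions G i" for y a
  proof -
    have le: "action_value G i \<pi> ?V y b \<le> ?V y" if "b \<in> actions G i" for b
      using br y that by (simp add: best_response_iff_action_value[OF \<pi> i])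
    have "(\<Sum>b\<in>actions G i. pmf (\<pi> i y) b * (?V y - action_value G i \<pi> ?V y b)) = 0"
      unfolding right_diff_distrib sum_subtractf val_action_value[OF \<pi> i y, symmetric]
      by (simp add: sum_strategy[OF strategyI[OF \<pi> i] i y] flip: sum_distrib_right)
    then have "pmf (\<pi> i y) a * (?V y - action_value G i \<pi> ?V y a) = 0"
      using a le finite_actions[OF i] by (subst (asm) sum_nonneg_eq_0_iff) auto
    then show ?thesis
      using full[OF y a] by simp
  qed
  have "?V y = bellman G i (\<pi>(i := \<sigma>)) ?V y" if y: "y \<in> states G" for y
    by (simp add: bellman_action_value[OF i] eq[OF y] sum_strategy[OF \<sigma> i y] flip: sum_distrib_right)
  from val_unique[OF joint_strategies_upd[OF \<pi> i \<sigma>] i this x] show ?thesis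
    by simp
qed

end

subsection \<open>A fixed point theorem for the unit cube\<close>

lemma tendsto_coordinatewise:
  fixes F :: "'a \<Rightarrow> 'b \<Rightarrow> 'c::topological_space"
  assumes "\<And>k. ((\<lambda>m. F m k) \<longlongrightarrow> z k) net"
  shows "(F \<longlongrightarrow> z) net"
  using assms limitin_componentwise[of "\<lambda>_. euclidean" UNIV F z net]
  by (simp add: euclidean_product_topology)

lemma compact_unit_cube: "compact {c :: 'a \<Rightarrow> real. \<forall>k. c k \<in> {0..1}}"
proof -
  have "compactin (product_topology (\<lambda>_::'a. euclidean :: real topology) UNIV) (PiE UNIV (\<lambda>_. {0..1}))"
    unfolding compactin_PiE by auto
  then show ?thesis
    by (simp add: euclidean_product_topology PiE_UNIV_domain Pi_def)
qed

text \<open>Brouwer's theorem from Kuhn's labelling lemma and compactness. Points are sequences of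
  which only the first \<open>n\<close> coordinates must be fixed, so the dimension may be a number
  computed from the game.\<close>

lemma brouwer_unit_cube:
  fixes f :: "(nat \<Rightarrow> real) \<Rightarrow> nat \<Rightarrow> real" and n :: nat
  defines "C \<equiv> {c. \<forall>k. c k \<in> {0..1}}"
  assumes cont: "\<And>k. k < n \<Longrightarrow> continuous_on C (\<lambda>c. f c k)"
    and range: "\<And>c k. c \<in> C \<Longrightarrow> k < n \<Longrightarrow> f c k \<in> {0..1}"
  shows "\<exists>c\<in>C. \<forall>k<n. f c k = c k"
proof -
  \<comment> \<open>\<open>Q\<close> serves all coordinates at once while \<open>R\<close> and
    \<open>S\<close> depend on \<open>k\<close>; so a single limit point of the \<open>Q\<close>
    handles every coordinate.\<close>
  have approx: "\<exists>Q\<in>C. \<forall>k<n. \<exists>R\<in>C. \<exists>S\<in>C. (\<forall>j. \<bar>R j - Q j\<bar> \<le> 1 / real p \<and> \<bar>S j - Q j\<bar> \<le> 1 / real p) \<and>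
      R k \<le> f R k \<and> f S k \<le> S k" if p: "0 < p" for p :: nat
  proof -
    define pt where "pt = (\<lambda>x j. if j < n then real (x j) / real p else 0)"
    \<comment> \<open>Label \<open>1\<close> means that \<open>f\<close> does not increase
      coordinate \<open>i\<close>, label \<open>0\<close> that it does not decrease it. On the two
      faces the label is forced as Kuhn's lemma demands, and is correct there because
      \<open>f\<close> maps into the cube.\<close>
    define label where "label = (\<lambda>x i. if x i = p \<or> (x i \<noteq> 0 \<and> f (pt x) i < pt x i) then 1 else 0 :: nat)"
    have pt: "pt x \<in> C" if "\<forall>j<n. x j \<le> p" for x
      using that p by (auto simp: pt_def C_def divide_simps)
    have label1: "f (pt x) i \<le> pt x i" if "\<forall>j<n. x j \<le> p" "i < n" "label x i = 1" for x i
      using range[OF pt[OF that(1)] that(2)] that p by (auto simp: label_def pt_def split: if_splits)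
    have label0: "pt x i \<le> f (pt x) i" if "\<forall>j<n. x j \<le> p" "i < n" "label x i = 0" for x i
      using range[OF pt[OF that(1)] that(2)] that p by (auto simp: label_def pt_def split: if_splits)
    have label01: "label x i = 0 \<or> label x i = 1" for x i
      by (auto simp: label_def)
    obtain q where q: "\<forall>i<n. q i < p" and rs: "\<forall>i<n. \<exists>r s. (\<forall>j<n. q j \<le> r j \<and> r j \<le> q j + 1) \<and>
        (\<forall>j<n. q j \<le> s j \<and> s j \<le> q j + 1) \<and> label r i \<noteq> label s i"
      by (rule kuhn_lemma[OF p, of n label]) (use p in \<open>auto simp: label_def\<close>)
    have near: "\<bar>pt r j - pt q j\<bar> \<le> 1 / real p" and le: "\<forall>j<n. r j \<le> p"
      if r: "\<forall>j<n. q j \<le> r j \<and> r j \<le> q j + 1" for r j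
    proof -
      have "real (r j) - real (q j) \<in> {0..1}" if "j < n"
        using r that by (auto simp flip: of_nat_diff)
      then show "\<bar>pt r j - pt q j\<bar> \<le> 1 / real p"
        using p by (auto simp: pt_def divide_right_mono simp flip: diff_divide_distrib)
      show "\<forall>j<n. r j \<le> p"
        using r q by (metis Suc_eq_plus1 Suc_leI le_trans)
    qed
    have "\<exists>R\<in>C. \<exists>S\<in>C. (\<forall>j. \<bar>R j - pt q j\<bar> \<le> 1 / real p \<and> \<bar>S j - pt q j\<bar> \<le> 1 / real p) \<and>
      R k \<le> f R k \<and> f S k \<le> S k" if k: "k < n" for k
    proof -
      obtain r s where r: "\<forall>j<n. q j \<le> r j \<and> r j \<le> q j + 1" and s: "\<forall>j<n. q j \<le> s j \<and> s j \<le> q j + 1"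
        and ne: "label r k \<noteq> label s k"
        using rs k by blast
      consider "label r k = 0" "label s k = 1" | "label r k = 1" "label s k = 0"
        using ne label01 by metis
      then show ?thesis
      proof cases
        case 1
        then show ?thesis
          using label0[OF le[OF r] k] label1[OF le[OF s] k] near[OF r] near[OF s] pt[OF le[OF r]] pt[OF le[OF s]]
          by (intro bexI[of _ "pt r"] bexI[of _ "pt s"]) auto
      next
        case 2
        then show ?thesis
          using label0[OF le[OF s] k] label1[OF le[OF r] k] near[OF r] near[OF s] pt[OF le[OF r]] pt[OF le[OF s]]
          by (intro bexI[of _ "pt r"] bexI[of _ "pt s"]) auto
      qed
    qed
    moreover have "pt q \<in> C"
      using q by (intro pt) (simp add: less_imp_le)
    ultimately show ?thesis
      by blast
  qed
  then have "\<forall>m. \<exists>Q\<in>C. \<forall>k<n. \<exists>R\<in>C. \<exists>S\<in>C. (\<forall>j. \<bar>R j - Q j\<bar> \<le> 1 / real (Suc m) \<and>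
      \<bar>S j - Q j\<bar> \<le> 1 / real (Suc m)) \<and> R k \<le> f R k \<and> f S k \<le> S k"
    by blast
  then obtain Q where Q: "Q m \<in> C"
    and QRS: "k < n \<Longrightarrow> \<exists>R\<in>C. \<exists>S\<in>C. (\<forall>j. \<bar>R j - Q m j\<bar> \<le> 1 / real (Suc m) \<and>
      \<bar>S j - Q m j\<bar> \<le> 1 / real (Suc m)) \<and> R k \<le> f R k \<and> f S k \<le> S k" for m k
    by metis
  \<comment> \<open>An infinite product, compact by Tychonoff; its index set is countable, so
    convergent subsequences exist.\<close>
  have "seq_compact C"
    unfolding C_def by (rule compact_imp_seq_compact[OF compact_unit_cube])
  then obtain z h where z: "z \<in> C" and h: "strict_mono h" and lim: "(Q \<circ> h) \<longlonglongrightarrow> z"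
    using Q by (auto elim!: seq_compactE[of C Q])
  have Qz: "(\<lambda>m. Q (h m) j) \<longlonglongrightarrow> z j" for j
    using lim continuous_on_tendsto_compose[OF continuous_on_product_coordinates lim] by (simp add: o_def)
  have inv: "(\<lambda>m. 1 / real (Suc (h m))) \<longlonglongrightarrow> 0"
    using LIMSEQ_subseq_LIMSEQ[OF lim_1_over_n[THEN LIMSEQ_Suc] h] by (simp add: o_def)
  have near_lim: "R \<longlonglongrightarrow> z" if "\<And>m j. \<bar>R m j - Q (h m) j\<bar> \<le> 1 / real (Suc (h m))" for R
  proof (rule tendsto_coordinatewise)
    fix j
    have "(\<lambda>m. R m j - Q (h m) j) \<longlonglongrightarrow> 0"
      by (rule Lim_null_comparison[OF _ inv]) (use that in auto)
    from tendsto_add[OF this Qz[of j]] show "(\<lambda>m. R m j) \<longlonglongrightarrow> z j"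
      by simp
  qed
  \<comment> \<open>\<open>R\<close> and \<open>S\<close> both converge to \<open>z\<close>, and
    their opposite inequalities meet in the limit.\<close>
  have "f z k = z k" if k: "k < n" for k
  proof -
    obtain R S where RS: "R m \<in> C" "S m \<in> C" "\<bar>R m j - Q (h m) j\<bar> \<le> 1 / real (Suc (h m))"
      "\<bar>S m j - Q (h m) j\<bar> \<le> 1 / real (Suc (h m))" "R m k \<le> f (R m) k" "f (S m) k \<le> S m k" for m j
      using QRS[OF k, of "h _"] by metis
    have R: "R \<longlonglongrightarrow> z" and S: "S \<longlonglongrightarrow> z"
      using RS by (auto intro!: near_lim)
    have "(\<lambda>m. f (R m) k) \<longlonglongrightarrow> f z k" "(\<lambda>m. f (S m) k) \<longlonglongrightarrow> f z k"
      using continuous_on_tendsto_compose[OF cont[OF k] R z] continuous_on_tendsto_compose[OF cont[OF k] S z] RS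
      by auto
    moreover have "(\<lambda>m. R m k) \<longlonglongrightarrow> z k" "(\<lambda>m. S m k) \<longlonglongrightarrow> z k"
      using continuous_on_tendsto_compose[OF continuous_on_product_coordinates R]
        continuous_on_tendsto_compose[OF continuous_on_product_coordinates S] by auto
    ultimately show ?thesis
      using RS by (intro antisym) (auto intro: LIMSEQ_le)
  qed
  then show ?thesis
    using z by blast
qed

subsection \<open>Equilibria of subgames\<close>

definition weight_pmf :: "'a set \<Rightarrow> ('a \<Rightarrow> real) \<Rightarrow> 'a pmf" where
  "weight_pmf A w = embed_pmf (\<lambda>a. if a \<in> A then w a else 0)"

lemma
  assumes "finite A" "\<And>a. a \<in> A \<Longrightarrow> 0 \<le> w a" "sum w A = 1"
  shows pmf_weight_pmf: "pmf (weight_pmf A w) a = (if a \<in> A then w a else 0)"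
    and weight_pmf_Dist: "weight_pmf A w \<in> Dist A"
proof -
  have "(\<integral>\<^sup>+a. ennreal (if a \<in> A then w a else 0) \<partial>count_space UNIV) = (\<Sum>a\<in>A. ennreal (w a))"
    using assms(1) by (subst nn_integral_count_space'[where A = A]) (auto split: if_splits)
  also have "\<dots> = 1"
    using assms by (subst sum_ennreal) auto
  finally have 1: "(\<integral>\<^sup>+a. ennreal (if a \<in> A then w a else 0) \<partial>count_space UNIV) = 1" .
  then show "pmf (weight_pmf A w) a = (if a \<in> A then w a else 0)"
    unfolding weight_pmf_def using assms(2) by (subst pmf_embed_pmf) auto
  show "weight_pmf A w \<in> Dist A"
    unfolding weight_pmf_def Dist_def using assms(2) 1 by (subst mem_Collect_eq, subst set_embed_pmf) auto
qed

context finite_stochastic_game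
begin

definition weights :: "'i set \<Rightarrow> ('i \<Rightarrow> 'x \<Rightarrow> 's \<Rightarrow> real) \<Rightarrow> bool" where
  "weights B w \<longleftrightarrow> B \<subseteq> players G \<and>
     (\<forall>i\<in>B. \<forall>x\<in>states G. (\<forall>a\<in>actions G i. 0 \<le> w i x a) \<and> sum (w i x) (actions G i) = 1)"

text \<open>Players outside \<open>B\<close> keep \<open>\<pi>\<close>. Both Nash's map and the
  perturbing curve are written in real weights and turned into profiles this way.\<close>

definition with_weights ::
  "'i set \<Rightarrow> ('i \<Rightarrow> 'x \<Rightarrow> 's pmf) \<Rightarrow> ('i \<Rightarrow> 'x \<Rightarrow> 's \<Rightarrow> real) \<Rightarrow> 'i \<Rightarrow> 'x \<Rightarrow> 's pmf" where
  "with_weights B \<pi> w i = (if i \<in> B then \<lambda>x\<in>states G. weight_pmf (actions G i) (w i x) else \<pi> i)"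

lemma with_weights_joint:
  assumes "\<pi> \<in> joint_strategies G" "weights B w"
  shows "with_weights B \<pi> w \<in> joint_strategies G"
proof -
  have "(\<lambda>x\<in>states G. weight_pmf (actions G i) (w i x)) \<in> strategies G i" if "i \<in> B" for i
    using assms(2) that finite_actions
    by (auto simp: strategies_def weights_def intro!: weight_pmf_Dist)
  then show ?thesis
    using assms by (auto simp: joint_strategies_def with_weights_def weights_def PiE_iff extensional_def)
qed

lemma pmf_with_weights:
  assumes "weights B w" "i \<in> B" "x \<in> states G" "a \<in> actions G i"
  shows "pmf (with_weights B \<pi> w i x) a = w i x a"
proof -
  have "i \<in> players G"
    using assms by (auto simp: weights_def)
  then have "pmf (weight_pmf (actions G i) (w i x)) a = (if a \<in> actions G i then w i x a else 0)"
    using assms by (intro pmf_weight_pmf finite_actions) (auto simp: weights_def)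
  then show ?thesis
    using assms by (simp add: with_weights_def)
qed

lemma actions_nonempty:
  assumes "\<pi> \<in> joint_strategies G" "i \<in> players G" "x \<in> states G"
  shows "actions G i \<noteq> {}"
  using assms set_pmf_not_empty[of "\<pi> i x"]
  by (auto simp: joint_strategies_def strategies_def Dist_def PiE_iff)

section \<open>Continuity of the value in the strategies\<close>

lemma bellman_shift:
  assumes \<pi>: "\<pi> \<in> joint_strategies G" and x: "x \<in> states G"
  shows "bellman G i \<pi> (\<lambda>y. V y + c) x = bellman G i \<pi> V x + discount G i * c"
proof -
  have "bellman G i \<pi> (\<lambda>y. V y + c) x - bellman G i \<pi> V x =
      (\<Sum>s\<in>joint_actions G. (\<Prod>j\<in>players G. pmf (\<pi> j x) (s j)) * (discount G i * c))"
    unfolding bellman_diff using sum_trans[OF x]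
    by (intro sum.cong refl) (simp flip: sum_distrib_right)
  also have "\<dots> = discount G i * c"
    by (simp add: sum_joint[OF \<pi> x] flip: sum_distrib_right)
  finally show ?thesis
    by simp
qed

text \<open>Shifting \<open>V\<close> up or down by \<open>d / (1 - discount G i)\<close> makes it a
  super- or subsolution, so an approximate solution is close to the value.\<close>

lemma val_dist_le:
  assumes \<pi>: "\<pi> \<in> joint_strategies G" and i: "i \<in> players G" and x: "x \<in> states G"
    and d: "\<And>y. y \<in> states G \<Longrightarrow> \<bar>bellman G i \<pi> V y - V y\<bar> \<le> d"
  shows "\<bar>val G i \<pi> x - V x\<bar> \<le> d / (1 - discount G i)"
proof -
  define K where "K = d / (1 - discount G i)"
  have K: "d + discount G i * K = K"
    using discount[OF i] by (simp add: K_def field_simps)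
  note val = val_eq_bellman[OF \<pi> i]
  have "val G i \<pi> x \<le> V x + K"
  proof (rule bellman_comparison[OF \<pi> i eq_refl[OF val] _ x])
    show "bellman G i \<pi> (\<lambda>y. V y + K) y \<le> V y + K" if "y \<in> states G" for y
      using d[OF that] K bellman_shift[OF \<pi> that, of i V K] by linarith
  qed
  moreover have "V x + - K \<le> val G i \<pi> x"
  proof (rule bellman_comparison[OF \<pi> i _ eq_refl[OF val[symmetric]] x])
    show "V y + - K \<le> bellman G i \<pi> (\<lambda>y. V y + - K) y" if "y \<in> states G" for y
      using d[OF that] K bellman_shift[OF \<pi> that, of i V "- K"] by simp
  qed
  ultimately show ?thesis
    by (simp add: K_def)
qed

text \<open>The limit value is inserted into the Bellman operators of the approaching profiles: the
  residual tends to \<open>0\<close> and bounds the error. The filter is general because both the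
  cube and the one-sided curve use it.\<close>

lemma tendsto_val:
  assumes \<tau>: "eventually (\<lambda>c. \<tau> c \<in> joint_strategies G) F" and \<pi>: "\<pi> \<in> joint_strategies G"
    and lim: "\<And>j y a. j \<in> players G \<Longrightarrow> y \<in> states G \<Longrightarrow> a \<in> actions G j \<Longrightarrow>
      ((\<lambda>c. pmf (\<tau> c j y) a) \<longlongrightarrow> pmf (\<pi> j y) a) F"
    and i: "i \<in> players G" and x: "x \<in> states G"
  shows "((\<lambda>c. val G i (\<tau> c) x) \<longlongrightarrow> val G i \<pi> x) F"
proof -
  let ?V = "val G i \<pi>"
  define d where "d = (\<lambda>c. \<Sum>y\<in>states G. \<bar>bellman G i (\<tau> c) ?V y - ?V y\<bar>)"
  have "((\<lambda>c. bellman G i (\<tau> c) ?V y) \<longlongrightarrow> bellman G i \<pi> ?V y) F" if "y \<in> states G" for y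
    unfolding bellman_def
    by (intro tendsto_sum tendsto_mult tendsto_prod tendsto_const lim that) (auto simp: joint_actions_def)
  then have "(d \<longlongrightarrow> (\<Sum>y\<in>states G. \<bar>bellman G i \<pi> ?V y - ?V y\<bar>)) F"
    unfolding d_def by (intro tendsto_sum tendsto_rabs tendsto_diff tendsto_const)
  also have "(\<Sum>y\<in>states G. \<bar>bellman G i \<pi> ?V y - ?V y\<bar>) = 0"
    by (rule sum.neutral) (simp flip: val_eq_bellman[OF \<pi> i])
  finally have "((\<lambda>c. d c / (1 - discount G i)) \<longlongrightarrow> 0) F"
    using discount[OF i] by (auto intro: tendsto_eq_intros)
  moreover have "eventually (\<lambda>c. norm (val G i (\<tau> c) x - ?V x) \<le> d c / (1 - discount G i)) F"
    using \<tau>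
  proof eventually_elim
    case (elim c)
    show ?case
      unfolding real_norm_def using elim i x
    proof (rule val_dist_le)
      show "\<bar>bellman G i (\<tau> c) ?V y - ?V y\<bar> \<le> d c" if "y \<in> states G" for y
        unfolding d_def using finite_states that
        by (intro member_le_sum[where f = "\<lambda>y. \<bar>bellman G i (\<tau> c) ?V y - ?V y\<bar>"]) auto
    qed
  qed
  ultimately have "((\<lambda>c. val G i (\<tau> c) x - ?V x) \<longlongrightarrow> 0) F"
    by (rule Lim_null_comparison[rotated])
  then show ?thesis
    by (simp add: LIM_zero_iff)
qed

lemma tendsto_action_value:
  assumes "\<And>j y a. j \<in> players G \<Longrightarrow> y \<in> states G \<Longrightarrow> a \<in> actions G j \<Longrightarrow>
      ((\<lambda>c. pmf (\<tau> c j y) a) \<longlongrightarrow> pmf (\<pi> j y) a) F"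
    and "\<And>y. y \<in> states G \<Longrightarrow> ((\<lambda>c. V c y) \<longlongrightarrow> U y) F" and "x \<in> states G"
  shows "((\<lambda>c. action_value G i (\<tau> c) (V c) x a) \<longlongrightarrow> action_value G i \<pi> U x a) F"
  unfolding action_value_def
  by (intro tendsto_sum tendsto_mult tendsto_prod tendsto_add tendsto_const assms)
     (auto simp: joint_actions_def)

text \<open>Nash's fixed point argument, run at each state with the current values as continuation
  payoffs; by the one-shot deviation principle, vanishing gains in this sense already make a best
  response.\<close>

lemma subgame_equilibrium:
  assumes \<pi>: "\<pi> \<in> joint_strategies G" and B: "B \<subseteq> players G"
  shows "\<exists>y\<in>joint_strategies G. (\<forall>i. i \<notin> B \<longrightarrow> y i = \<pi> i) \<and> (\<forall>i\<in>B. best_response G i y)"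
proof -
  \<comment> \<open>One cube coordinate per player, state and action, numbered by \<open>e\<close>;
    coordinates from \<open>card K\<close> on stay free.\<close>
  define K where "K = (SIGMA i:B. states G \<times> actions G i)"
  have "finite K"
    unfolding K_def using finite_states finite_actions finite_subset[OF B finite_players] B by auto
  then obtain e where e: "bij_betw e K {0..<card K}"
    using ex_bij_betw_finite_nat by blast
  define S where "S = (\<lambda>(c::nat \<Rightarrow> real) i x. \<Sum>a\<in>actions G i. c (e (i, x, a)))"
  define \<rho> where "\<rho> = (\<lambda>c i x a. (c (e (i, x, a)) + max 0 (1 - S c i x) * (1 / card (actions G i))) / max 1 (S c i x))"
  define Y where "Y = (\<lambda>c. with_weights B \<pi> (\<rho> c))"
  define \<phi> where "\<phi> = (\<lambda>c i x a. max 0 (action_value G i (Y c) (val G i (Y c)) x a - val G i (Y c) x))"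
  \<comment> \<open>\<open>\<rho>\<close> retracts the cube onto the mixed strategies, and \<open>f\<close> is Nash's map with one-shot gains \<open>\<phi>\<close>\<close>
  define f where "f = (\<lambda>c k. case inv_into K e k of (i, x, a) \<Rightarrow>
    (\<rho> c i x a + \<phi> c i x a) / (1 + (\<Sum>b\<in>actions G i. \<phi> c i x b)))"
  define C where "C = {c :: nat \<Rightarrow> real. \<forall>k. c k \<in> {0..1}}"
  have \<rho>_sum: "(\<Sum>a\<in>actions G i. \<rho> c i x a) = 1" if "i \<in> B" "x \<in> states G" for c i x
  proof -
    have "card (actions G i) > 0"
      using actions_nonempty[OF \<pi> _ that(2)] finite_actions B that(1) by (auto simp: card_gt_0_iff)
    then have "(\<Sum>a\<in>actions G i. \<rho> c i x a) = (S c i x + max 0 (1 - S c i x)) / max 1 (S c i x)"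
      by (simp add: \<rho>_def sum.distrib S_def flip: sum_divide_distrib)
    then show ?thesis
      by (auto simp: max_def)
  qed
  have \<rho>_nonneg: "0 \<le> \<rho> c i x a" if "c \<in> C" for c i x a
    using that by (auto simp: \<rho>_def C_def intro!: divide_nonneg_nonneg add_nonneg_nonneg)
  have W: "weights B (\<rho> c)" if "c \<in> C" for c
    using \<rho>_sum \<rho>_nonneg[OF that] B by (auto simp: weights_def)
  have Y: "Y c \<in> joint_strategies G" if "c \<in> C" for c
    unfolding Y_def using \<pi> W[OF that] by (rule with_weights_joint)
  have pmf_Y: "pmf (Y c i x) a = \<rho> c i x a" if "c \<in> C" "i \<in> B" "x \<in> states G" "a \<in> actions G i" for c i x a
    unfolding Y_def using W[OF that(1)] that(2-) by (rule pmf_with_weights)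
  have \<phi>_nonneg: "0 \<le> \<phi> c i x a" for c i x a
    by (simp add: \<phi>_def)
  have e_inv: "inv_into K e (e (i, x, a)) = (i, x, a)" "e (i, x, a) < card K"
    if "i \<in> B" "x \<in> states G" "a \<in> actions G i" for i x a
    using e that by (auto simp: K_def bij_betw_def)
  have inv: "\<exists>i\<in>B. \<exists>x\<in>states G. \<exists>a\<in>actions G i. inv_into K e k = (i, x, a)" if "k < card K" for k
  proof -
    have "inv_into K e k \<in> K"
      using e that by (intro inv_into_into) (auto simp: bij_betw_def)
    then show ?thesis
      by (auto simp: K_def)
  qed
  have "\<exists>c\<in>{c. \<forall>k. c k \<in> {0..1}}. \<forall>k<card K. f c k = c k"
  proof (rule brouwer_unit_cube, fold C_def)
    fix k assume "k < card K"
    then obtain i x a where i: "i \<in> B" and x: "x \<in> states G" and a: "a \<in> actions G i"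
      and k: "inv_into K e k = (i, x, a)"
      using inv by blast
    have ip: "i \<in> players G"
      using i B by auto
    show "continuous_on C (\<lambda>c. f c k)"
      unfolding continuous_on_def
    proof
      fix c0 assume c0: "c0 \<in> C"
      let ?F = "at c0 within C"
      have C_ev: "eventually (\<lambda>c. c \<in> C) ?F"
        by (auto simp: eventually_at_topological)
      have coord: "((\<lambda>c. c k) \<longlongrightarrow> c0 k) ?F" for k
        using c0 continuous_on_subset[OF continuous_on_product_coordinates[of k] subset_UNIV, of C]
        by (auto simp: continuous_on_def)
      have S: "((\<lambda>c. S c j y) \<longlongrightarrow> S c0 j y) ?F" for j y
        unfolding S_def by (intro tendsto_sum coord)
      have \<rho>: "((\<lambda>c. \<rho> c j y b) \<longlongrightarrow> \<rho> c0 j y b) ?F" for j y b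
        unfolding \<rho>_def using S coord
        by (intro tendsto_divide[of _ _ _ "\<lambda>c. max 1 (S c j y)"] tendsto_add tendsto_max tendsto_const
              tendsto_diff tendsto_mult) (auto simp: max_def)
      have lim: "((\<lambda>c. pmf (Y c j y) b) \<longlongrightarrow> pmf (Y c0 j y) b) ?F"
        if "y \<in> states G" "b \<in> actions G j" for j y b
      proof (cases "j \<in> B")
        case True
        have "eventually (\<lambda>c. \<rho> c j y b = pmf (Y c j y) b) ?F"
          using C_ev by eventually_elim (use pmf_Y True that in auto)
        with \<rho>[of j y b] show ?thesis
          unfolding pmf_Y[OF c0 True that] by (rule Lim_transform_eventually)
      qed (simp add: Y_def with_weights_def)
      have Y_ev: "eventually (\<lambda>c. Y c \<in> joint_strategies G) ?F"
        using C_ev by eventually_elim (rule Y)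
      have V: "((\<lambda>c. val G i (Y c) y) \<longlongrightarrow> val G i (Y c0) y) ?F" if "y \<in> states G" for y
        using lim ip that by (intro tendsto_val[OF Y_ev Y[OF c0]])
      have \<phi>: "((\<lambda>c. \<phi> c i x b) \<longlongrightarrow> \<phi> c0 i x b) ?F" for b
        unfolding \<phi>_def by (intro tendsto_max tendsto_diff tendsto_const tendsto_action_value lim V x)
      show "((\<lambda>c. f c k) \<longlongrightarrow> f c0 k) ?F"
        unfolding f_def k prod.case using \<phi>_nonneg
        by (intro tendsto_divide tendsto_add tendsto_sum tendsto_const \<rho> \<phi>)
           (simp add: add_nonneg_eq_0_iff sum_nonneg)
    qed
    fix c assume c: "c \<in> C"
    have "\<rho> c i x a \<le> (\<Sum>b\<in>actions G i. \<rho> c i x b)" "\<phi> c i x a \<le> (\<Sum>b\<in>actions G i. \<phi> c i x b)"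
      using a finite_actions[OF ip] \<rho>_nonneg[OF c] \<phi>_nonneg by (auto intro!: member_le_sum)
    moreover have "0 \<le> (\<Sum>b\<in>actions G i. \<phi> c i x b)"
      by (simp add: sum_nonneg \<phi>_nonneg)
    ultimately show "f c k \<in> {0..1}"
      using \<rho>_sum[OF i x] \<rho>_nonneg[OF c, of i x a] \<phi>_nonneg[of c i x a]
      by (simp add: f_def k)
  qed
  then obtain c where c: "c \<in> C" and fix_c: "\<And>k. k < card K \<Longrightarrow> f c k = c k"
    by (auto simp: C_def)
  have "best_response G i (Y c)" if i: "i \<in> B" for i
  proof -
    have ip: "i \<in> players G"
      using i B by auto
    have "\<phi> c i x a = 0" if x: "x \<in> states G" and a: "a \<in> actions G i" for x a
    proof -
      let ?A = "actions G i" and ?V = "val G i (Y c)"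
      let ?Q = "action_value G i (Y c) ?V x"
      define T where "T = (\<Sum>b\<in>?A. \<phi> c i x b)"
      have T: "0 \<le> T"
        by (simp add: T_def sum_nonneg \<phi>_nonneg)
      have fixed: "c (e (i, x, b)) = (\<rho> c i x b + \<phi> c i x b) / (1 + T)" if "b \<in> ?A" for b
        using fix_c[OF e_inv(2)[OF i x that]] e_inv(1)[OF i x that] by (simp add: f_def T_def)
      \<comment> \<open>The values of \<open>f\<close> are normalised, so at a fixed point the total
        weight is \<open>1\<close>. There is then neither missing mass to spread nor excess to
        divide out, and \<open>\<rho>\<close> returns \<open>c\<close> itself.\<close>
      have "S c i x = (\<Sum>b\<in>?A. (\<rho> c i x b + \<phi> c i x b) / (1 + T))"
        unfolding S_def by (intro sum.cong refl fixed)
      also have "\<dots> = 1"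
        using T by (simp add: sum.distrib \<rho>_sum[OF i x] T_def flip: sum_divide_distrib)
      finally have "\<rho> c i x b = c (e (i, x, b))" for b
        by (simp add: \<rho>_def)
      then have \<phi>_eq: "\<phi> c i x b = \<rho> c i x b * T" if "b \<in> ?A" for b
        using fixed[OF that] T by (simp add: field_simps)
      \<comment> \<open>A positive part squared is itself times the signed gain. With
        \<open>\<phi>_eq\<close> the sum of squares becomes \<open>T\<close> times the average gain
        under \<open>\<rho>\<close>, which is zero because the value averages the action
        values.\<close>
      have sq: "\<phi> c i x b ^ 2 = \<phi> c i x b * (?Q b - ?V x)" for b
        by (auto simp: \<phi>_def max_def power2_eq_square)
      have "(\<Sum>b\<in>?A. \<phi> c i x b ^ 2) = (\<Sum>b\<in>?A. \<rho> c i x b * T * (?Q b - ?V x))"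
        unfolding sq by (intro sum.cong refl) (simp add: \<phi>_eq)
      also have "\<dots> = T * ((\<Sum>b\<in>?A. \<rho> c i x b * ?Q b) - (\<Sum>b\<in>?A. \<rho> c i x b) * ?V x)"
        by (simp add: sum_distrib_left sum_distrib_right right_diff_distrib sum_subtractf mult_ac)
      also have "(\<Sum>b\<in>?A. \<rho> c i x b * ?Q b) = ?V x"
        by (rule trans[OF sum.cong[OF refl] val_action_value[OF Y[OF c] ip x, symmetric]])
           (simp add: pmf_Y[OF c i x])
      finally have "(\<Sum>b\<in>?A. \<phi> c i x b ^ 2) = 0"
        by (simp add: \<rho>_sum[OF i x])
      then show ?thesis
        using a finite_actions[OF ip] by (simp add: sum_nonneg_eq_0_iff)
    qed
    then have "action_value G i (Y c) (val G i (Y c)) x a \<le> val G i (Y c) x"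
      if "x \<in> states G" "a \<in> actions G i" for x a
      using that by (fastforce simp: \<phi>_def max_def split: if_splits)
    then show ?thesis
      by (simp add: best_response_iff_action_value[OF Y[OF c] ip])
  qed
  then show ?thesis
    using Y[OF c] by (intro bexI[of _ "Y c"]) (auto simp: Y_def with_weights_def)
qed

end

subsection \<open>Rational functions\<close>

text \<open>A quotient of polynomials in cross-multiplied form, with one denominator that vanishes
  nowhere on \<open>S\<close>.\<close>

definition rational_on :: "real set \<Rightarrow> (real \<Rightarrow> real) \<Rightarrow> bool" where
  "rational_on S f \<longleftrightarrow> (\<exists>p q. \<forall>t\<in>S. poly q t \<noteq> 0 \<and> f t * poly q t = poly p t)"

lemma rational_onE:
  assumes "rational_on S f"
  obtains p q where "\<And>t. t \<in> S \<Longrightarrow> poly q t \<noteq> 0" "\<And>t. t \<in> S \<Longrightarrow> f t * poly q t = poly p t"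
  using assms by (auto simp: rational_on_def)

lemma rational_onI:
  assumes "\<And>t. t \<in> S \<Longrightarrow> poly q t \<noteq> 0" "\<And>t. t \<in> S \<Longrightarrow> f t * poly q t = poly p t"
  shows "rational_on S f"
  using assms by (auto simp: rational_on_def)

lemma rational_on_cong: "rational_on S f \<Longrightarrow> (\<And>t. t \<in> S \<Longrightarrow> f t = g t) \<Longrightarrow> rational_on S g"
  by (auto simp: rational_on_def)

lemma rational_on_const: "rational_on S (\<lambda>_. c)"
  by (rule rational_onI[of _ 1 _ "[:c:]"]) auto

lemma rational_on_id: "rational_on S (\<lambda>t. t)"
  by (rule rational_onI[of _ 1 _ "[:0, 1:]"]) auto

lemma rational_on_add:
  assumes "rational_on S f" "rational_on S g"
  shows "rational_on S (\<lambda>t. f t + g t)"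
proof -
  obtain p q p' q' where *: "\<And>t. t \<in> S \<Longrightarrow> poly q t \<noteq> 0" "\<And>t. t \<in> S \<Longrightarrow> f t * poly q t = poly p t"
    "\<And>t. t \<in> S \<Longrightarrow> poly q' t \<noteq> 0" "\<And>t. t \<in> S \<Longrightarrow> g t * poly q' t = poly p' t"
    using assms by (metis rational_onE)
  show ?thesis
    by (rule rational_onI[of _ "q * q'" _ "p * q' + p' * q"]) (use * in \<open>auto simp: algebra_simps simp flip: *(2,4)\<close>)
qed

lemma rational_on_mult:
  assumes "rational_on S f" "rational_on S g"
  shows "rational_on S (\<lambda>t. f t * g t)"
proof -
  obtain p q p' q' where *: "\<And>t. t \<in> S \<Longrightarrow> poly q t \<noteq> 0" "\<And>t. t \<in> S \<Longrightarrow> f t * poly q t = poly p t"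
    "\<And>t. t \<in> S \<Longrightarrow> poly q' t \<noteq> 0" "\<And>t. t \<in> S \<Longrightarrow> g t * poly q' t = poly p' t"
    using assms by (metis rational_onE)
  show ?thesis
    by (rule rational_onI[of _ "q * q'" _ "p * p'"]) (use * in \<open>auto simp: mult_ac simp flip: *(2,4)\<close>)
qed

lemma rational_on_inverse:
  assumes "rational_on S f" "\<And>t. t \<in> S \<Longrightarrow> f t \<noteq> 0"
  shows "rational_on S (\<lambda>t. inverse (f t))"
proof -
  obtain p q where *: "\<And>t. t \<in> S \<Longrightarrow> poly q t \<noteq> 0" "\<And>t. t \<in> S \<Longrightarrow> f t * poly q t = poly p t"
    using assms(1) by (metis rational_onE)
  show ?thesis
    by (rule rational_onI[of _ p _ q]) (use * assms(2) in \<open>auto simp: field_simps simp flip: *(2)\<close>)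
qed

lemma rational_on_diff: "rational_on S f \<Longrightarrow> rational_on S g \<Longrightarrow> rational_on S (\<lambda>t. f t - g t)"
  using rational_on_add[OF _ rational_on_mult[OF rational_on_const[of S "-1"]], of f g] by simp

lemma rational_on_divide:
  "rational_on S f \<Longrightarrow> rational_on S g \<Longrightarrow> (\<And>t. t \<in> S \<Longrightarrow> g t \<noteq> 0) \<Longrightarrow> rational_on S (\<lambda>t. f t / g t)"
  unfolding divide_inverse by (intro rational_on_mult rational_on_inverse)

lemma rational_on_sum: "(\<And>k. k \<in> A \<Longrightarrow> rational_on S (f k)) \<Longrightarrow> rational_on S (\<lambda>t. \<Sum>k\<in>A. f k t)"
  by (induction A rule: infinite_finite_induct) (auto intro: rational_on_const rational_on_add)

lemma rational_on_prod: "(\<And>k. k \<in> A \<Longrightarrow> rational_on S (f k)) \<Longrightarrow> rational_on S (\<lambda>t. \<Prod>k\<in>A. f k t)"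
  by (induction A rule: infinite_finite_induct) (auto intro: rational_on_const rational_on_mult)

lemmas rational_on_intros = rational_on_const rational_on_id rational_on_add rational_on_diff
  rational_on_mult rational_on_divide rational_on_sum rational_on_prod

text \<open>A single nonzero value makes the numerator a nonzero polynomial. This is the only source
  of genericity.\<close>

lemma rational_on_finite_zeros:
  assumes "rational_on S f" "s \<in> S" "f s \<noteq> 0"
  shows "finite {t \<in> S. f t = 0}"
proof -
  obtain p q where *: "\<And>t. t \<in> S \<Longrightarrow> poly q t \<noteq> 0" "\<And>t. t \<in> S \<Longrightarrow> f t * poly q t = poly p t"
    using assms(1) by (metis rational_onE)
  then have "poly p s \<noteq> 0"
    using assms(2,3) by (metis no_zero_divisors)
  then have "finite {t. poly p t = 0}"
    by (intro poly_roots_finite) auto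
  moreover have "{t \<in> S. f t = 0} \<subseteq> {t. poly p t = 0}"
    by (auto simp flip: *(2))
  ultimately show ?thesis
    by (rule rev_finite_subset)
qed

text \<open>Gaussian elimination: eliminating the unknown \<open>z\<close> from \<open>v = b + M v\<close> keeps the coefficients
  nonnegative and the row sums below \<open>1\<close>, so that no pivot \<open>1 - M z z\<close> vanishes on \<open>S\<close>.\<close>

lemma rational_on_linear_system:
  fixes M :: "real \<Rightarrow> 'x \<Rightarrow> 'x \<Rightarrow> real"
  assumes "finite X"
    and "\<And>x y. x \<in> X \<Longrightarrow> y \<in> X \<Longrightarrow> rational_on S (\<lambda>t. M t x y)"
    and "\<And>x. x \<in> X \<Longrightarrow> rational_on S (\<lambda>t. b t x)"
    and "\<And>t x y. t \<in> S \<Longrightarrow> x \<in> X \<Longrightarrow> y \<in> X \<Longrightarrow> 0 \<le> M t x y"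
    and "\<And>t x. t \<in> S \<Longrightarrow> x \<in> X \<Longrightarrow> (\<Sum>y\<in>X. M t x y) < 1"
    and "\<And>t x. t \<in> S \<Longrightarrow> x \<in> X \<Longrightarrow> v t x = b t x + (\<Sum>y\<in>X. M t x y * v t y)"
    and "x \<in> X"
  shows "rational_on S (\<lambda>t. v t x)"
  using assms
\<comment> \<open>\<open>v\<close> stays fixed: the reduced system has new coefficients but the same
  solution.\<close>
proof (induction X arbitrary: M b x rule: finite_induct)
  case (insert z X)
  define D where "D = (\<lambda>t. 1 - M t z z)"
  note rat = insert.prems(1,2) and nonneg = insert.prems(3)
  have sum_less: "M t x z + (\<Sum>y\<in>X. M t x y) < 1" if "t \<in> S" "x \<in> insert z X" for t x
    using insert.prems(4)[OF that] insert.hyps by simp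
  have row: "(\<Sum>y\<in>X. M t z y) < D t" if "t \<in> S" for t
    using sum_less[OF that, of z] by (simp add: D_def)
  have D: "D t > 0" if "t \<in> S" for t
    using row[OF that] sum_nonneg[of X "M t z"] nonneg[OF that] by (meson insertCI le_less_trans)
  have D_rat: "rational_on S D"
    unfolding D_def by (intro rational_on_intros rat) auto
  have eq: "v t x = b t x + M t x z * v t z + (\<Sum>y\<in>X. M t x y * v t y)"
    if "t \<in> S" "x \<in> insert z X" for t x
    using insert.prems(5)[OF that] insert.hyps by simp
  have vz: "v t z = (b t z + (\<Sum>y\<in>X. M t z y * v t y)) / D t" if "t \<in> S" for t
    using eq[OF that, of z] D[OF that] by (simp add: D_def field_simps)
  have X: "rational_on S (\<lambda>t. v t x)" if x: "x \<in> X" for x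
  proof (rule insert.IH[of "\<lambda>t x y. M t x y + M t x z * M t z y / D t" "\<lambda>t x. b t x + M t x z * b t z / D t"])
    show "rational_on S (\<lambda>t. M t x y + M t x z * M t z y / D t)" if "x \<in> X" "y \<in> X" for x y
      using that D by (intro rational_on_intros rat D_rat) force+
    show "rational_on S (\<lambda>t. b t x + M t x z * b t z / D t)" if "x \<in> X" for x
      using that D by (intro rational_on_intros rat D_rat) force+
    show "0 \<le> M t x y + M t x z * M t z y / D t" if "t \<in> S" "x \<in> X" "y \<in> X" for t x y
      using that D[of t] nonneg by simp
    show "(\<Sum>y\<in>X. M t x y + M t x z * M t z y / D t) < 1" if t: "t \<in> S" and x: "x \<in> X" for t x
    proof -
      have "(\<Sum>y\<in>X. M t x y + M t x z * M t z y / D t) =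
          (\<Sum>y\<in>X. M t x y) + M t x z * ((\<Sum>y\<in>X. M t z y) / D t)"
        by (simp add: sum.distrib sum_distrib_left sum_divide_distrib)
      \<comment> \<open>Row \<open>z\<close> divided by its pivot sums to less than
        \<open>1\<close>, so the coefficient \<open>M t x z\<close> is redistributed without
        increasing the row sum.\<close>
      also have "\<dots> \<le> (\<Sum>y\<in>X. M t x y) + M t x z * 1"
        using row[OF t] D[OF t] nonneg[OF t] x by (intro add_left_mono mult_left_mono) auto
      also have "\<dots> < 1"
        using sum_less[OF t, of x] x by simp
      finally show ?thesis .
    qed
    show "v t x = b t x + M t x z * b t z / D t + (\<Sum>y\<in>X. (M t x y + M t x z * M t z y / D t) * v t y)"
      if t: "t \<in> S" and x: "x \<in> X" for t x
    proof -
      have "(\<Sum>y\<in>X. (M t x y + M t x z * M t z y / D t) * v t y) =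
          (\<Sum>y\<in>X. M t x y * v t y) + M t x z * (\<Sum>y\<in>X. M t z y * v t y) / D t"
        by (simp add: algebra_simps sum.distrib sum_distrib_left sum_divide_distrib)
      moreover have "v t x = b t x + M t x z * ((b t z + (\<Sum>y\<in>X. M t z y * v t y)) / D t) +
          (\<Sum>y\<in>X. M t x y * v t y)"
        using eq[OF t, of x] x vz[OF t] by simp
      ultimately show ?thesis
        by (simp add: add_divide_distrib distrib_left)
    qed
  qed (use x in auto)
  have "rational_on S (\<lambda>t. (b t z + (\<Sum>y\<in>X. M t z y * v t y)) / D t)"
    using D by (intro rational_on_intros rat D_rat X) force+
  then have "rational_on S (\<lambda>t. v t z)"
    by (rule rational_on_cong) (simp add: vz)
  then show ?case
    using X insert.prems(6) by auto
qed simp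

subsection \<open>Satisficing paths\<close>

context finite_stochastic_game
begin

text \<open>Read as a linear system for the values, the Bellman equation has nonnegative
  coefficients, rational along the curve, with all row sums equal to the discount factor.\<close>

lemma rational_on_val:
  assumes \<tau>: "\<And>t. t \<in> S \<Longrightarrow> \<tau> t \<in> joint_strategies G"
    and rat: "\<And>j y a. j \<in> players G \<Longrightarrow> y \<in> states G \<Longrightarrow> a \<in> actions G j \<Longrightarrow>
      rational_on S (\<lambda>t. pmf (\<tau> t j y) a)"
    and i: "i \<in> players G" and x: "x \<in> states G"
  shows "rational_on S (\<lambda>t. val G i (\<tau> t) x)"
proof -
  let ?w = "\<lambda>t x s. \<Prod>j\<in>players G. pmf (\<tau> t j x) (s j)"
  define M where "M = (\<lambda>t x y. \<Sum>s\<in>joint_actions G. ?w t x s * (discount G i * pmf (trans G x s) y))"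
  define b where "b = (\<lambda>t x. \<Sum>s\<in>joint_actions G. ?w t x s * payoff G i x s)"
  have "rational_on S (\<lambda>t. ?w t y s)" if "y \<in> states G" "s \<in> joint_actions G" for y s
    using that by (intro rational_on_prod rat) (auto simp: joint_actions_def)
  note rat_w = this
  show ?thesis
  proof (rule rational_on_linear_system[OF finite_states, where M = M and b = b and S = S])
    show "rational_on S (\<lambda>t. M t y z)" if "y \<in> states G" for y z
      unfolding M_def using that by (intro rational_on_sum rational_on_mult rational_on_const rat_w)
    show "rational_on S (\<lambda>t. b t y)" if "y \<in> states G" for y
      unfolding b_def using that by (intro rational_on_sum rational_on_mult rational_on_const rat_w)
    show "0 \<le> M t y z" for t y z
      unfolding M_def using discount[OF i] by (intro sum_nonneg mult_nonneg_nonneg prod_nonneg) auto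
    show "(\<Sum>z\<in>states G. M t y z) < 1" if t: "t \<in> S" and y: "y \<in> states G" for t y
    proof -
      have "(\<Sum>z\<in>states G. M t y z) =
          (\<Sum>s\<in>joint_actions G. ?w t y s * (discount G i * (\<Sum>z\<in>states G. pmf (trans G y s) z)))"
        unfolding M_def by (subst sum.swap) (simp add: sum_distrib_left)
      also have "\<dots> = (\<Sum>s\<in>joint_actions G. ?w t y s * discount G i)"
        by (intro sum.cong refl) (simp add: sum_trans[OF y])
      also have "\<dots> = discount G i"
        by (simp add: sum_joint[OF \<tau>[OF t] y] flip: sum_distrib_right)
      finally show ?thesis
        using discount[OF i] by simp
    qed
    show "val G i (\<tau> t) y = b t y + (\<Sum>z\<in>states G. M t y z * val G i (\<tau> t) z)"
      if t: "t \<in> S" and y: "y \<in> states G" for t y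
    proof -
      have "(\<Sum>z\<in>states G. M t y z * val G i (\<tau> t) z) = (\<Sum>s\<in>joint_actions G. ?w t y s *
          (discount G i * (\<Sum>z\<in>states G. pmf (trans G y s) z * val G i (\<tau> t) z)))"
        unfolding M_def sum_distrib_right by (subst sum.swap) (simp add: sum_distrib_left mult_ac)
      then have "b t y + (\<Sum>z\<in>states G. M t y z * val G i (\<tau> t) z) =
          bellman G i (\<tau> t) (val G i (\<tau> t)) y"
        by (simp add: b_def bellman_def distrib_left sum.distrib)
      then show ?thesis
        using val_eq_bellman[OF \<tau>[OF t] i y] by (rule trans[OF _ sym, rotated])
    qed
  qed (use x in auto)
qed

lemma joint_strategies_eqI:
  assumes "\<pi> \<in> joint_strategies G" "\<pi>' \<in> joint_strategies G"
    and "\<And>i x a. i \<in> players G \<Longrightarrow> x \<in> states G \<Longrightarrow> a \<in> actions G i \<Longrightarrow> pmf (\<pi> i x) a = pmf (\<pi>' i x) a"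
  shows "\<pi> = \<pi>'"
proof (rule PiE_ext)
  fix i assume i: "i \<in> players G"
  show "\<pi> i = \<pi>' i"
  proof (rule PiE_ext)
    fix x assume x: "x \<in> states G"
    have "set_pmf (\<pi> i x) \<subseteq> actions G i" "set_pmf (\<pi>' i x) \<subseteq> actions G i"
      using assms(1,2) i x by (auto simp: joint_strategies_def strategies_def Dist_def PiE_iff subset_iff)
    then show "\<pi> i x = \<pi>' i x"
      using assms(3)[OF i x] by (intro pmf_eqI) (metis in_mono pmf_eq_0_set_pmf)
  qed (use strategyI[OF assms(1) i] strategyI[OF assms(2) i] in \<open>auto simp: strategies_def\<close>)
qed (use assms(1,2) in \<open>auto simp: joint_strategies_def\<close>)

text \<open>The curve runs from \<open>y\<close> at \<open>0\<close> to \<open>\<sigma>\<close> at \<open>1\<close> and is fully mixed in between. A fully mixed best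
  response makes its player indifferent between all strategies, which is an equation between
  rational functions along the curve. It fails at \<open>1\<close>, hence near \<open>0\<close>.\<close>

lemma unsatisfied_near_subgame_equilibrium:
  assumes \<sigma>: "\<sigma> \<in> joint_strategies G" and y: "y \<in> joint_strategies G" and B: "B \<subseteq> players G"
    and agree: "\<And>i. i \<notin> B \<Longrightarrow> y i = \<sigma> i"
    and unsat: "\<And>i. i \<in> B \<Longrightarrow> \<not> best_response G i \<sigma>"
    and k: "k \<in> players G" "\<not> best_response G k y"
  shows "\<exists>\<tau>\<in>joint_strategies G. (\<forall>i. i \<notin> B \<longrightarrow> \<tau> i = \<sigma> i) \<and>
    (\<forall>i\<in>insert k B. \<not> best_response G i \<tau>)"
proof -
  \<comment> \<open>The weights \<open>1 - t\<close>, \<open>t * (1 - t)\<close> and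
    \<open>t * t\<close> of \<open>y\<close>, the uniform strategy and \<open>\<sigma>\<close> sum
    to \<open>1\<close>; on the unit interval the middle one is positive exactly in the
    interior.\<close>
  define w where "w = (\<lambda>t i x a. (1 - t) * pmf (y i x) a +
    t * ((1 - t) * (1 / real (card (actions G i))) + t * pmf (\<sigma> i x) a))"
  define \<tau> where "\<tau> = (\<lambda>t. with_weights B \<sigma> (w t))"
  let ?I = "{0..1::real}"
  have card_pos: "0 < real (card (actions G i))" if "i \<in> players G" "x \<in> states G" for i x
    using actions_nonempty[OF \<sigma> that] finite_actions[OF that(1)] by (simp add: card_gt_0_iff)
  have W: "weights B (w t)" if t: "t \<in> ?I" for t
    unfolding weights_def
  proof (intro conjI ballI B)
    fix i x assume i: "i \<in> B" and x: "x \<in> states G"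
    then have ip: "i \<in> players G"
      using B by auto
    show "0 \<le> w t i x a" for a
      using t by (simp add: w_def)
    have "sum (w t i x) (actions G i) = (1 - t) * (\<Sum>a\<in>actions G i. pmf (y i x) a) +
        t * ((1 - t) * (\<Sum>a\<in>actions G i. 1 / real (card (actions G i))) +
          t * (\<Sum>a\<in>actions G i. pmf (\<sigma> i x) a))"
      by (simp only: w_def sum.distrib sum_distrib_left[symmetric])
    also have "\<dots> = (1 - t) + t * ((1 - t) + t)"
      using sum_strategy[OF strategyI[OF y ip] ip x] sum_strategy[OF strategyI[OF \<sigma> ip] ip x] card_pos[OF ip x]
      by simp
    finally show "sum (w t i x) (actions G i) = 1"
      by simp
  qed
  have \<tau>: "\<tau> t \<in> joint_strategies G" if "t \<in> ?I" for t
    unfolding \<tau>_def using \<sigma> W[OF that] by (rule with_weights_joint)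
  have pmf_\<tau>: "pmf (\<tau> t i x) a = w t i x a" if "t \<in> ?I" "i \<in> B" "x \<in> states G" "a \<in> actions G i" for t i x a
    unfolding \<tau>_def using W[OF that(1)] that(2-) by (rule pmf_with_weights)
  have \<tau>_out: "\<tau> t i = \<sigma> i" if "i \<notin> B" for t i
    using that by (simp add: \<tau>_def with_weights_def)
  have \<tau>_1: "\<tau> 1 = \<sigma>"
  proof (rule joint_strategies_eqI[OF \<tau> \<sigma>])
    show "pmf (\<tau> 1 i x) a = pmf (\<sigma> i x) a" if "x \<in> states G" "a \<in> actions G i" for i x a
      using pmf_\<tau>[of 1 i x a] \<tau>_out[of i 1] that by (cases "i \<in> B") (auto simp: w_def)
  qed simp
  have \<tau>_0: "\<tau> 0 = y"
  proof (rule joint_strategies_eqI[OF \<tau> y])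
    show "pmf (\<tau> 0 i x) a = pmf (y i x) a" if "x \<in> states G" "a \<in> actions G i" for i x a
      using pmf_\<tau>[of 0 i x a] \<tau>_out[of i 0] agree[of i] that by (cases "i \<in> B") (auto simp: w_def)
  qed simp
  have rat: "rational_on ?I (\<lambda>t. pmf (\<tau> t j x) a)" if "x \<in> states G" "a \<in> actions G j" for j x a
  proof (cases "j \<in> B")
    case True
    have "rational_on ?I (\<lambda>t. w t j x a)"
      unfolding w_def by (intro rational_on_add rational_on_mult rational_on_diff rational_on_const rational_on_id)
    then show ?thesis
      by (rule rational_on_cong) (use True that pmf_\<tau> in auto)
  qed (simp add: \<tau>_out rational_on_const)
  have rat_upd: "rational_on ?I (\<lambda>t. val G i ((\<tau> t)(i := \<sigma>')) x)"
    if "\<sigma>' \<in> strategies G i" "i \<in> players G" "x \<in> states G" for i \<sigma>' x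
  proof (rule rational_on_val[OF joint_strategies_upd[OF \<tau> that(2,1)] _ that(2,3)])
    show "rational_on ?I (\<lambda>t. pmf (((\<tau> t)(i := \<sigma>')) j z) a)" if "z \<in> states G" "a \<in> actions G j" for j z a
      using rat[OF that] by (cases "j = i") (auto intro: rational_on_const)
  qed
  have inside: "eventually (\<lambda>t. t \<in> {0<..<1}) (at_right (0::real))"
    by (rule eventually_at_right_real) simp
  have B_unsat: "eventually (\<lambda>t. \<not> best_response G i (\<tau> t)) (at_right 0)" if i: "i \<in> B" for i
  proof -
    have ip: "i \<in> players G"
      using i B by auto
    obtain x \<sigma>' where x: "x \<in> states G" and \<sigma>': "\<sigma>' \<in> strategies G i"
      and less: "val G i \<sigma> x < val G i (\<sigma>(i := \<sigma>')) x"
      using unsat[OF i] by (auto simp: best_response_iff[OF \<sigma> ip] not_le)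
    \<comment> \<open>A fully mixed best response at \<open>t\<close> makes both terms equal to the
      value of \<open>\<tau> t\<close>, so \<open>f t = 0\<close>; at \<open>1\<close> the
      difference is the strict gain \<open>less\<close>.\<close>
    define f where "f = (\<lambda>t. val G i ((\<tau> t)(i := \<sigma>')) x - val G i ((\<tau> t)(i := \<sigma> i)) x)"
    have "rational_on ?I f"
      unfolding f_def using \<sigma>' strategyI[OF \<sigma> ip] ip x by (intro rational_on_diff rat_upd)
    then have "finite {t \<in> ?I. f t = 0}"
      by (rule rational_on_finite_zeros[of _ _ 1]) (use less in \<open>auto simp: f_def \<tau>_1\<close>)
    \<comment> \<open>The finitely many zeros are avoided close to \<open>0\<close>; should
      \<open>0\<close> be one of them, \<open>at_right\<close> excludes it.\<close>
    then have "eventually (\<lambda>t. \<forall>r\<in>{t \<in> ?I. f t = 0}. t \<noteq> r) (at_right 0)"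
      by (rule eventually_ball_finite) (auto intro: eventually_neq_at_within)
    then show ?thesis
      using inside
    proof eventually_elim
      case (elim t)
      then have t: "t \<in> ?I"
        by auto
      with elim(1) have "f t \<noteq> 0"
        by blast
      show ?case
      proof
        assume br: "best_response G i (\<tau> t)"
        have "0 < pmf (\<tau> t i z) a" if "z \<in> states G" "a \<in> actions G i" for z a
        proof -
          have "0 < (1 - t) * (1 / real (card (actions G i)))"
            using elim(2) card_pos[OF ip that(1)] by simp
          then have "0 < t * ((1 - t) * (1 / real (card (actions G i))) + t * pmf (\<sigma> i z) a)"
            using elim(2) card_pos[OF ip that(1)] by (intro mult_pos_pos add_pos_nonneg) auto
          then show ?thesis
            using elim(2) by (simp add: pmf_\<tau>[OF t i that] w_def add_nonneg_pos)
        qed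
        then have "val G i ((\<tau> t)(i := \<rho>)) x = val G i (\<tau> t) x" if "\<rho> \<in> strategies G i" for \<rho>
          using fully_mixed_best_response_indifferent[OF \<tau>[OF t] ip br _ that x] by blast
        then show False
          using \<open>f t \<noteq> 0\<close> \<sigma>' strategyI[OF \<sigma> ip] by (simp add: f_def)
      qed
    qed
  qed
  \<comment> \<open>No genericity here: one fixed profitable deviation from \<open>y\<close> stays
    profitable by continuity of both values.\<close>
  have k_unsat: "eventually (\<lambda>t. \<not> best_response G k (\<tau> t)) (at_right 0)"
  proof -
    obtain x \<sigma>' where x: "x \<in> states G" and \<sigma>': "\<sigma>' \<in> strategies G k"
      and less: "val G k y x < val G k (y(k := \<sigma>')) x"
      using k(2) by (auto simp: best_response_iff[OF y k(1)] not_le)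
    have ev: "eventually (\<lambda>t. t \<in> ?I) (at_right 0)"
      using inside by eventually_elim auto
    have lim: "((\<lambda>t. pmf (\<tau> t j z) a) \<longlongrightarrow> pmf (y j z) a) (at_right 0)"
      if "z \<in> states G" "a \<in> actions G j" for j z a
    proof (cases "j \<in> B")
      case True
      have "((\<lambda>t. w t j z a) \<longlongrightarrow> w 0 j z a) (at_right 0)"
        unfolding w_def by (intro tendsto_intros)
      moreover have "eventually (\<lambda>t. w t j z a = pmf (\<tau> t j z) a) (at_right 0)"
        using ev by eventually_elim (use pmf_\<tau> True that in auto)
      ultimately have "((\<lambda>t. pmf (\<tau> t j z) a) \<longlongrightarrow> w 0 j z a) (at_right 0)"
        by (rule Lim_transform_eventually)
      then show ?thesis
        by (simp add: w_def)
    qed (simp add: \<tau>_out agree)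
    have lim_val: "((\<lambda>t. val G k (\<tau> t) x) \<longlongrightarrow> val G k y x) (at_right 0)"
      by (rule tendsto_val[OF eventually_mono[OF ev \<tau>] y lim k(1) x])
    have lim_val': "((\<lambda>t. val G k ((\<tau> t)(k := \<sigma>')) x) \<longlongrightarrow> val G k (y(k := \<sigma>')) x) (at_right 0)"
    proof (rule tendsto_val[OF _ joint_strategies_upd[OF y k(1) \<sigma>'] _ k(1) x])
      show "eventually (\<lambda>t. (\<tau> t)(k := \<sigma>') \<in> joint_strategies G) (at_right 0)"
        using ev by eventually_elim (rule joint_strategies_upd[OF \<tau> k(1) \<sigma>'])
      show "((\<lambda>t. pmf (((\<tau> t)(k := \<sigma>')) j z) a) \<longlongrightarrow> pmf ((y(k := \<sigma>')) j z) a) (at_right 0)"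
        if "z \<in> states G" "a \<in> actions G j" for j z a
        using lim[OF that] by (cases "j = k") auto
    qed
    have "eventually (\<lambda>t. 0 < val G k ((\<tau> t)(k := \<sigma>')) x - val G k (\<tau> t) x) (at_right 0)"
      using less by (intro order_tendstoD(1)[OF tendsto_diff[OF lim_val' lim_val]]) simp
    then show ?thesis
      using ev by eventually_elim (use x \<sigma>' in \<open>auto simp: best_response_iff[OF \<tau> k(1)] not_le\<close>)
  qed
  have "eventually (\<lambda>t. \<forall>i\<in>B. \<not> best_response G i (\<tau> t)) (at_right 0)"
    using finite_subset[OF B finite_players] B_unsat by (intro eventually_ball_finite) auto
  then have "eventually (\<lambda>t. t \<in> ?I \<and> (\<forall>i\<in>insert k B. \<not> best_response G i (\<tau> t))) (at_right 0)"
    using k_unsat inside by eventually_elim auto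
  then obtain t where "t \<in> ?I" "\<forall>i\<in>insert k B. \<not> best_response G i (\<tau> t)"
    using eventually_happens'[OF trivial_limit_at_right_real] by blast
  then show ?thesis
    using \<tau> \<tau>_out by (intro bexI[of _ "\<tau> t"]) auto
qed

lemma satisficing_path_exists:
  assumes "\<sigma>\<^sub>0 \<in> joint_strategies G"
  shows "\<exists>T \<sigma>. satisficing_path G T \<sigma> \<and> \<sigma> 0 = \<sigma>\<^sub>0 \<and> mixed_equilibrium G (\<sigma> T)"
  using assms
proof (induction "card {i \<in> players G. best_response G i \<sigma>\<^sub>0}" arbitrary: \<sigma>\<^sub>0 rule: less_induct)
  case less
  define A where "A = (\<lambda>\<pi>. {i \<in> players G. best_response G i \<pi>})"
  have finA: "finite (A \<pi>)" for \<pi>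
    by (simp add: A_def finite_players)
  show ?case
  proof (cases "\<exists>\<tau>\<in>joint_strategies G. (\<forall>i\<in>A \<sigma>\<^sub>0. \<tau> i = \<sigma>\<^sub>0 i) \<and> A \<tau> \<subset> A \<sigma>\<^sub>0")
    case True
    then obtain \<tau> where \<tau>: "\<tau> \<in> joint_strategies G" "\<forall>i\<in>A \<sigma>\<^sub>0. \<tau> i = \<sigma>\<^sub>0 i" "A \<tau> \<subset> A \<sigma>\<^sub>0"
      by blast
    have "card (A \<tau>) < card (A \<sigma>\<^sub>0)"
      using finA \<tau>(3) by (rule psubset_card_mono)
    then obtain T \<sigma> where path: "satisficing_path G T \<sigma>" "\<sigma> 0 = \<tau>" "mixed_equilibrium G (\<sigma> T)"
      using less.hyps[of \<tau>] \<tau>(1) unfolding A_def by blast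
    define \<sigma>' where "\<sigma>' = case_nat \<sigma>\<^sub>0 \<sigma>"
    have "satisficing_path G (Suc T) \<sigma>'"
      using path(1,2) less.prems \<tau>(2)
      by (auto simp: satisficing_path_def \<sigma>'_def A_def split: nat.split)
    moreover have "\<sigma>' 0 = \<sigma>\<^sub>0" "\<sigma>' (Suc T) = \<sigma> T"
      by (simp_all add: \<sigma>'_def)
    ultimately show ?thesis
      using path(3) by metis
  next
    case False
    define B where "B = players G - A \<sigma>\<^sub>0"
    have B: "B \<subseteq> players G" "\<And>i. i \<in> B \<Longrightarrow> \<not> best_response G i \<sigma>\<^sub>0"
      by (auto simp: B_def A_def)
    obtain y where y: "y \<in> joint_strategies G" "\<And>i. i \<notin> B \<Longrightarrow> y i = \<sigma>\<^sub>0 i"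
      and br: "\<And>i. i \<in> B \<Longrightarrow> best_response G i y"
      using subgame_equilibrium[OF less.prems B(1)] by blast
    have "best_response G k y" if k: "k \<in> players G" for k
    proof (rule ccontr)
      assume nbr: "\<not> best_response G k y"
      then obtain \<tau> where \<tau>: "\<tau> \<in> joint_strategies G" "\<forall>i. i \<notin> B \<longrightarrow> \<tau> i = \<sigma>\<^sub>0 i"
        "\<forall>i\<in>insert k B. \<not> best_response G i \<tau>"
        using unsatisfied_near_subgame_equilibrium[OF less.prems y(1) B(1) y(2) B(2) k] by blast
      \<comment> \<open>The members of \<open>B\<close> are satisfied at \<open>y\<close>, so
        \<open>k\<close> is not among them and was satisfied at the start. At \<open>\<tau>\<close>
        it is lost while no mover is gained, which the case assumption forbids.\<close>
      have "k \<in> A \<sigma>\<^sub>0" "k \<notin> A \<tau>" "A \<tau> \<subseteq> A \<sigma>\<^sub>0"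
        using nbr br k \<tau>(3) by (auto simp: A_def B_def)
      moreover have "\<forall>i\<in>A \<sigma>\<^sub>0. \<tau> i = \<sigma>\<^sub>0 i"
        using \<tau>(2) by (auto simp: B_def)
      ultimately show False
        using False \<tau>(1) by blast
    qed
    then have "mixed_equilibrium G y"
      using y(1) by (simp add: mixed_equilibrium_def)
    \<comment> \<open>If the initial profile is an equilibrium already, \<open>B\<close> is empty
      and this step stands still.\<close>
    moreover have "satisficing_path G 1 (case_nat \<sigma>\<^sub>0 (\<lambda>_. y))"
      using less.prems y by (auto simp: satisficing_path_def B_def A_def split: nat.split)
    ultimately show ?thesis
      by (intro exI[of _ 1] exI[of _ "case_nat \<sigma>\<^sub>0 (\<lambda>_. y)"]) simp
  qed
qed

end

theorem corollary3:
  fixes G :: "('i, 'x, 's) game" and \<sigma>\<^sub>0 :: "'i \<Rightarrow> 'x \<Rightarrow> 's pmf"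
  assumes "stochastic_game G"
    and "\<And>i. i \<in> players G \<Longrightarrow> finite (actions G i)"
    and "\<sigma>\<^sub>0 \<in> joint_strategies G"
  shows "\<exists>T \<sigma>. satisficing_path G T \<sigma> \<and> \<sigma> 0 = \<sigma>\<^sub>0 \<and> mixed_equilibrium G (\<sigma> T)"
proof -
  interpret finite_stochastic_game G
    using assms(1,2) by unfold_locales
  show ?thesis
    using assms(3) by (rule satisficing_path_exists)
qed

end
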